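(* Let $\mu=\sum_{i=1}^m\alpha_i\,\delta(x_i)$ and $\nu=\sum_{j=1}^n\beta_j\,\delta(y_j)$ be probability measures on $\mathbb{R}^d$, where $\alpha_i>0$, $\beta_j>0$, $\sum_i\alpha_i=\sum_j\beta_j=1$, the points $x_1,\dots,x_m$ are pairwise distinct and the points $y_1,\dots,y_n$ are pairwise distinct. Suppose that it is not the case that the optimal transport plan between $\mu$ and $\nu$ (for the quadratic cost) is unique and a perfect matching. Then there exist $c_0>0$ and $C>0$ (which may depend on $d,\mu,\nu$) such that for all $\sigma\in(0,c_0)$, $$W_2^2(\mu,\nu)-W_2^2(\mu*\mathcal{N}_\sigma,\nu*\mathcal{N}_\sigma)\ \ge\ C\,\sigma .$$
   Context: $W_2^2(\mu,\nu)=\inf_{\pi\in\Pi(\mu,\nu)}\int\|x-y\|^2\,d\pi(x,y)$, where $\Pi(\mu,\nu)$ is the set of couplings (transport plans) of $\mu$ and $\nu$; an optimal transport plan is a minimizer. $\mathcal{N}_\sigma$ is the centered Gaussian measure on $\mathbb{R}^d$ with covariance $\sigma^2 I_d$, $*$ is convolution, and $\delta(x)$ is the Dirac mass at $x$. A transport plan between $\mu$ and $\nu$ is a perfect matching if $m=n$ and there is a permutation $p$ of $\{1,\dots,m\}$ such that $\alpha_i=\beta_{p(i)}$ for all $i$ and, under the plan, all the mass at $y_{p(i)}$ comes from $x_i$ only, i.e. the plan is $\sum_i\alpha_i\,\delta_{(x_i,y_{p(i)})}$. *)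

theory Defs
  imports "HOL-Probability.Probability" "HOL-Combinatorics.Permutations"
begin

text \<open>The measure \<open>\<Sum>i\<in>I. a i * \<delta>(x i)\<close>; see \<open>emeasure_dirac_sum\<close> below.\<close>

definition dirac_sum :: "'i set \<Rightarrow> ('i \<Rightarrow> real) \<Rightarrow> ('i \<Rightarrow> 'a::topological_space) \<Rightarrow> 'a measure" where
  "dirac_sum I a x = distr (point_measure I (\<lambda>i. ennreal (a i))) borel x"

lemma emeasure_dirac_sum:
  assumes "finite I" "A \<in> sets borel"
  shows "emeasure (dirac_sum I a x) A = (\<Sum>i\<in>I. ennreal (a i) * emeasure (return borel (x i)) A)"
proof -
  have "x \<in> measurable (point_measure I (\<lambda>i. ennreal (a i))) borel"
    by (auto simp: measurable_def space_point_measure sets_point_measure)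
  then have "emeasure (dirac_sum I a x) A
      = emeasure (point_measure I (\<lambda>i. ennreal (a i))) (x -` A \<inter> I)"
    unfolding dirac_sum_def using assms(2)
    by (simp add: emeasure_distr space_point_measure)
  also have "\<dots> = (\<Sum>i\<in>x -` A \<inter> I. ennreal (a i))"
    using assms(1) by (subst emeasure_point_measure_finite) auto
  also have "\<dots> = (\<Sum>i\<in>I. ennreal (a i) * emeasure (return borel (x i)) A)"
    using assms by (intro sum.mono_neutral_cong_left) (auto simp: indicator_def)
  finally show ?thesis .
qed

text \<open>Couplings carry the product \<open>\<sigma>\<close>-algebra, which for Borel measures on a second countable
  space is the Borel \<open>\<sigma>\<close>-algebra of the product (\<open>borel_prod\<close>).\<close>

definition couplings :: "'a measure \<Rightarrow> 'b measure \<Rightarrow> ('a \<times> 'b) measure set" where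
  "couplings M N = {P. sets P = sets (M \<Otimes>\<^sub>M N) \<and> distr P M fst = M \<and> distr P N snd = N}"

definition transport_cost :: "('a::real_normed_vector \<times> 'a) measure \<Rightarrow> ennreal" where
  "transport_cost P = (\<integral>\<^sup>+z. ennreal ((norm (fst z - snd z))\<^sup>2) \<partial>P)"

text \<open>The squared 2-Wasserstein distance; it is finite as soon as both measures are probability
  measures with finite second moments.\<close>

definition W2_sq :: "'a::real_normed_vector measure \<Rightarrow> 'a measure \<Rightarrow> ennreal" where
  "W2_sq M N = (INF P\<in>couplings M N. transport_cost P)"

definition optimal_plans :: "'a::real_normed_vector measure \<Rightarrow> 'a measure \<Rightarrow> ('a \<times> 'a) measure set" where
  "optimal_plans M N =
     {P \<in> couplings M N. \<forall>Q\<in>couplings M N. transport_cost P \<le> transport_cost Q}"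

definition perfect_matching ::
  "nat \<Rightarrow> (nat \<Rightarrow> real) \<Rightarrow> (nat \<Rightarrow> 'a::topological_space) \<Rightarrow>
   nat \<Rightarrow> (nat \<Rightarrow> real) \<Rightarrow> (nat \<Rightarrow> 'a) \<Rightarrow> ('a \<times> 'a) measure \<Rightarrow> bool" where
  "perfect_matching m \<alpha> x n \<beta> y P \<longleftrightarrow> m = n \<and>
     (\<exists>p. p permutes {1..m} \<and> (\<forall>i\<in>{1..m}. \<alpha> i = \<beta> (p i)) \<and>
          P = dirac_sum {1..m} \<alpha> (\<lambda>i. (x i, y (p i))))"

text \<open>The centered Gaussian measure with covariance \<open>\<sigma>\<^sup>2 I\<close>, for \<open>\<sigma> > 0\<close>.\<close>

definition gaussian :: "real \<Rightarrow> 'a::euclidean_space measure" where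
  "gaussian \<sigma> = density lborel
     (\<lambda>z. ennreal (exp (- (norm z)\<^sup>2 / (2 * \<sigma>\<^sup>2)) / sqrt (2 * pi * \<sigma>\<^sup>2) ^ DIM('a)))"

lemma gaussian_eq_prod_normal_density:
  "(gaussian \<sigma> :: 'a::euclidean_space measure) =
     density lborel (\<lambda>z. ennreal (\<Prod>b\<in>Basis. normal_density 0 \<sigma> (z \<bullet> b)))"
proof -
  have "(norm z)\<^sup>2 = (\<Sum>b\<in>Basis. (z \<bullet> b)\<^sup>2)" for z :: 'a
    by (subst power2_norm_eq_inner, subst euclidean_inner) (simp add: power2_eq_square)
  then have "(\<Prod>b\<in>Basis. normal_density 0 \<sigma> (z \<bullet> b)) =
      exp (- (norm z)\<^sup>2 / (2 * \<sigma>\<^sup>2)) / sqrt (2 * pi * \<sigma>\<^sup>2) ^ DIM('a)" for z :: 'a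
    by (simp add: normal_density_def prod_dividef exp_sum [symmetric]
        sum_negf sum_divide_distrib [symmetric])
  then show ?thesis
    by (simp add: gaussian_def)
qed

end

theory Submission
  imports Defs
begin

text \<open>If no optimal matrix of transported masses had two positive entries in a common row or column,
  midpoints of optimal matrices would show that all of them have the same support, so the optimal plan
  would be unique and a perfect matching. Hence, up to exchanging the two measures, some optimal plan
  moves mass at least \<open>t > 0\<close> from one point \<open>x\<close> to each of two points \<open>y \<noteq> y'\<close>. Let \<open>w = y - y'\<close>.
  After smoothing, mass can be redirected from \<open>y'\<close> to \<open>y\<close> where the noise \<open>z\<close> at \<open>x\<close> has \<open>z \<bullet> w > 0\<close>,
  and from \<open>y\<close> to \<open>y'\<close> where \<open>z \<bullet> w < 0\<close>; independent noise is placed on the target side. This preserves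
  both marginals by symmetry of the noise. It lowers the cost by \<open>2 t E\<bar>z \<bullet> w\<bar>\<close>, which is linear in \<open>\<sigma>\<close>,
  while the independent noise costs only \<open>O(\<sigma>\<^sup>2)\<close>.\<close>

section \<open>Gaussian measures\<close>

lemma sets_gaussian [simp, measurable_cong]: "sets (gaussian \<sigma>) = sets borel"
  by (simp add: gaussian_def)

lemma space_gaussian [simp]: "space (gaussian \<sigma>) = UNIV"
  by (simp add: gaussian_def)

text \<open>The density is a product over the coordinates, so Tonelli reduces such integrals to
  one-dimensional normal ones. Total mass and second moments are both obtained from this.\<close>

lemma nn_integral_gaussian_prod:
  fixes f :: "'a::euclidean_space \<Rightarrow> real \<Rightarrow> real"
  assumes [measurable]: "\<And>b. b \<in> Basis \<Longrightarrow> f b \<in> borel_measurable borel"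
    and nonneg: "\<And>b t. b \<in> Basis \<Longrightarrow> 0 \<le> f b t"
  shows "(\<integral>\<^sup>+z. ennreal (\<Prod>b\<in>Basis. f b (z \<bullet> b)) \<partial>gaussian \<sigma>)
       = (\<Prod>b\<in>Basis. \<integral>\<^sup>+t. ennreal (normal_density 0 \<sigma> t * f b t) \<partial>lborel)"
proof -
  have "(\<integral>\<^sup>+z. ennreal (\<Prod>b\<in>Basis. f b (z \<bullet> b)) \<partial>gaussian \<sigma>)
      = (\<integral>\<^sup>+z. (\<Prod>b\<in>Basis. ennreal (normal_density 0 \<sigma> (z \<bullet> b) * f b (z \<bullet> b))) \<partial>lborel)"
    unfolding gaussian_eq_prod_normal_density
    by (subst nn_integral_density)
       (auto intro!: nn_integral_cong simp: prod_ennreal nonneg prod_nonneg prod.distrib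
          ennreal_mult [symmetric])
  also have "\<dots> = (\<Prod>b\<in>Basis. \<integral>\<^sup>+t. ennreal (normal_density 0 \<sigma> t * f b t) \<partial>lborel)"
    by (rule nn_integral_lborel_prod) (auto simp: nonneg)
  finally show ?thesis .
qed

lemma prob_space_gaussian:
  assumes "\<sigma> > 0"
  shows "prob_space (gaussian \<sigma> :: 'a::euclidean_space measure)"
proof
  have *: "(\<integral>\<^sup>+t. ennreal (normal_density 0 \<sigma> t) \<partial>lborel) = 1"
    by (subst nn_integral_eq_integral) (use assms in auto)
  show "emeasure (gaussian \<sigma>) (space (gaussian \<sigma> :: 'a measure)) = 1"
    using nn_integral_gaussian_prod [of "\<lambda>(_::'a) _. 1" \<sigma>] by (simp add: *)
qed

lemma integrable_gaussian_norm_square: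
  assumes "\<sigma> > 0"
  shows "integrable (gaussian \<sigma> :: 'a::euclidean_space measure) (\<lambda>z. (norm z)\<^sup>2)"
proof -
  interpret prob_space "gaussian \<sigma> :: 'a measure"
    by (rule prob_space_gaussian) fact
  have "integrable (gaussian \<sigma>) (\<lambda>z::'a. (z \<bullet> c)\<^sup>2)" if c: "c \<in> Basis" for c
  proof (rule integrableI_nonneg)
    \<comment> \<open>The integrand is padded with factors 1 in the other coordinates so that it
      becomes a product.\<close>
    have "(\<integral>\<^sup>+z. ennreal ((z \<bullet> c)\<^sup>2) \<partial>gaussian \<sigma>)
        = (\<integral>\<^sup>+(z::'a). ennreal (\<Prod>b\<in>Basis. (if b = c then (z \<bullet> b)\<^sup>2 else 1)) \<partial>gaussian \<sigma>)"
      using c by (simp add: prod.delta')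
    also have "\<dots> = (\<Prod>b\<in>Basis. \<integral>\<^sup>+t. ennreal (normal_density 0 \<sigma> t * (if b = c then t\<^sup>2 else 1)) \<partial>lborel)"
      by (rule nn_integral_gaussian_prod) auto
    also have "\<dots> < \<infinity>"
    proof -
      have "integrable lborel (\<lambda>t. normal_density 0 \<sigma> t * (if b = c then t\<^sup>2 else 1))" for b
        using integrable_normal_moment [OF assms, of 0 2] integrable_normal_density [OF assms, of 0]
        by (cases "b = c") simp_all
      then have "(\<integral>\<^sup>+t. ennreal (normal_density 0 \<sigma> t * (if b = c then t\<^sup>2 else 1)) \<partial>lborel) < \<infinity>" for b
        by (subst nn_integral_eq_integral) auto
      then show ?thesis
        by (simp add: ennreal_prod_eq_top less_top [symmetric])
    qed
    finally show "(\<integral>\<^sup>+z. ennreal ((z \<bullet> c)\<^sup>2) \<partial>gaussian \<sigma>) < \<infinity>" .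
  qed auto
  then have "integrable (gaussian \<sigma>) (\<lambda>z::'a. \<Sum>c\<in>Basis. (z \<bullet> c)\<^sup>2)"
    by auto
  moreover have "(norm z)\<^sup>2 = (\<Sum>c\<in>Basis. (z \<bullet> c)\<^sup>2)" for z :: 'a
    by (subst power2_norm_eq_inner, subst euclidean_inner) (simp add: power2_eq_square)
  ultimately show ?thesis
    by simp
qed

text \<open>Under the dilation Lebesgue measure picks up a power of the absolute value of
  \<open>c\<close>, which the normalising constant absorbs. Negative \<open>c\<close> is included:
  \<open>c = -1\<close> yields the reflection symmetry below.\<close>

lemma distr_gaussian_scaleR:
  assumes "c \<noteq> 0"
  shows "distr (gaussian \<sigma>) borel (\<lambda>z::'a::euclidean_space. c *\<^sub>R z) = gaussian (c * \<sigma>)"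
proof -
  let ?g = "\<lambda>\<sigma> z::'a. exp (- (norm z)\<^sup>2 / (2 * \<sigma>\<^sup>2)) / sqrt (2 * pi * \<sigma>\<^sup>2) ^ DIM('a)"
  have scale: "\<bar>c\<bar> ^ DIM('a) * ?g (c * \<sigma>) (c *\<^sub>R z) = ?g \<sigma> z" for z :: 'a
    using assms
    by (simp add: power_mult_distrib real_sqrt_mult field_simps)
  have "gaussian (c * \<sigma>) = density (density (distr lborel borel (\<lambda>z. c *\<^sub>R z)) (\<lambda>_. ennreal (\<bar>c\<bar> ^ DIM('a)))) (\<lambda>z. ennreal (?g (c * \<sigma>) z))"
    unfolding gaussian_def using lborel_affine [OF assms, of "0::'a"] by simp
  also have "\<dots> = density (distr lborel borel (\<lambda>z. c *\<^sub>R z)) (\<lambda>z. ennreal (\<bar>c\<bar> ^ DIM('a) * ?g (c * \<sigma>) z))"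
    by (subst density_density_eq) (auto simp flip: ennreal_mult)
  also have "\<dots> = distr (density lborel (\<lambda>z. ennreal (\<bar>c\<bar> ^ DIM('a) * ?g (c * \<sigma>) (c *\<^sub>R z)))) borel (\<lambda>z. c *\<^sub>R z)"
    by (subst density_distr) auto
  also have "\<dots> = distr (gaussian \<sigma>) borel (\<lambda>z. c *\<^sub>R z)"
    by (simp only: scale gaussian_def)
  finally show ?thesis ..
qed

lemma distr_gaussian_uminus:
  "distr (gaussian \<sigma>) borel uminus = (gaussian \<sigma> :: 'a::euclidean_space measure)"
  using distr_gaussian_scaleR [of "-1" \<sigma>, where 'a = 'a]
  by (simp add: gaussian_def)

lemma integrable_abs_inner:
  fixes G :: "'a::euclidean_space measure"
  assumes "finite_measure G" and [measurable_cong]: "sets G = sets borel"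
    and int: "integrable G (\<lambda>z. (norm z)\<^sup>2)"
  shows "integrable G (\<lambda>z. \<bar>z \<bullet> w\<bar>)"
proof -
  interpret finite_measure G by fact
  show ?thesis
  proof (rule Bochner_Integration.integrable_bound)
    show "integrable G (\<lambda>z. (norm z)\<^sup>2 + (norm w)\<^sup>2)"
      using int by auto
    show "AE z in G. norm \<bar>z \<bullet> w\<bar> \<le> norm ((norm z)\<^sup>2 + (norm w)\<^sup>2)"
    proof (rule AE_I2)
      fix z
      have "\<bar>z \<bullet> w\<bar> \<le> norm z * norm w"
        by (rule Cauchy_Schwarz_ineq2)
      also have "\<dots> \<le> (norm z)\<^sup>2 + (norm w)\<^sup>2"
        using sum_squares_bound [of "norm z" "norm w"] mult_nonneg_nonneg [of "norm z" "norm w"]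
          norm_ge_zero [of z] norm_ge_zero [of w]
        by argo
      finally show "norm \<bar>z \<bullet> w\<bar> \<le> norm ((norm z)\<^sup>2 + (norm w)\<^sup>2)"
        by simp
    qed
  qed measurable
qed

text \<open>A vanishing integral would put almost every \<open>z\<close> on the hyperplane
  orthogonal to \<open>w\<close>; as the density is positive everywhere, this would hold
  Lebesgue-almost everywhere, but hyperplanes are null sets. The strict sign makes the final
  constant \<open>C\<close> positive.\<close>

lemma gaussian_abs_inner_pos:
  fixes w :: "'a::euclidean_space"
  assumes "\<sigma> > 0" "w \<noteq> 0"
  shows "(\<integral>z. \<bar>z \<bullet> w\<bar> \<partial>gaussian \<sigma>) > 0"
proof -
  interpret prob_space "gaussian \<sigma> :: 'a measure"
    by (rule prob_space_gaussian) fact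
  have int: "integrable (gaussian \<sigma>) (\<lambda>z. \<bar>z \<bullet> w\<bar>)"
    using assms integrable_gaussian_norm_square
    by (intro integrable_abs_inner) (auto simp: finite_measure_axioms)
  have "(\<integral>z. \<bar>z \<bullet> w\<bar> \<partial>gaussian \<sigma>) \<noteq> 0"
  proof
    assume "(\<integral>z. \<bar>z \<bullet> w\<bar> \<partial>gaussian \<sigma>) = 0"
    then have "AE z in gaussian \<sigma>. z \<bullet> w = 0"
      using integral_nonneg_eq_0_iff_AE [OF int] by auto
    then have *: "AE z in lborel. z \<bullet> w = 0"
      using assms(1) unfolding gaussian_def by (subst (asm) AE_density) auto
    have "negligible {z. w \<bullet> z = 0}"
      using assms(2) by (auto intro: negligible_hyperplane)
    then have "AE z in lborel. z \<bullet> w \<noteq> 0"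
      using AE_not_in [of "{z. w \<bullet> z = 0}" lebesgue]
      by (simp add: negligible_iff_null_sets AE_completion_iff inner_commute)
    with * have "AE z in (lborel :: 'a measure). False"
      by eventually_elim simp
    then show False
      using ae_filter_eq_bot_iff [of "lborel :: 'a measure"] by (simp add: eventually_False)
  qed
  moreover have "(\<integral>z. \<bar>z \<bullet> w\<bar> \<partial>gaussian \<sigma>) \<ge> 0"
    by simp
  ultimately show ?thesis
    by linarith
qed

text \<open>Transfer to the standard Gaussian separates the two orders in \<sigma>: first absolute
  moments scale linearly, second moments quadratically.\<close>

lemma integral_gaussian_scale:
  fixes f :: "'a::euclidean_space \<Rightarrow> real"
  assumes "\<sigma> > 0" and [measurable]: "f \<in> borel_measurable borel"
  shows "(\<integral>z. f z \<partial>gaussian \<sigma>) = (\<integral>z. f (\<sigma> *\<^sub>R z) \<partial>gaussian 1)"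
proof -
  have "gaussian \<sigma> = distr (gaussian 1) borel (\<lambda>z::'a. \<sigma> *\<^sub>R z)"
    using distr_gaussian_scaleR [of \<sigma> 1, where 'a = 'a] assms by simp
  then show ?thesis
    by (simp add: integral_distr)
qed

section \<open>Couplings of finitely supported measures\<close>

lemma measurable_fst_borel [measurable]:
  "fst \<in> measurable borel (borel :: 'a::topological_space measure)"
  by (intro borel_measurable_continuous_onI continuous_on_fst continuous_on_id)

lemma measurable_snd_borel [measurable]:
  "snd \<in> measurable borel (borel :: 'a::topological_space measure)"
  by (intro borel_measurable_continuous_onI continuous_on_snd continuous_on_id)

lemma sets_dirac_sum [simp, measurable_cong]: "sets (dirac_sum I a x) = sets borel"
  by (simp add: dirac_sum_def)

lemma space_dirac_sum [simp]: "space (dirac_sum I a x) = UNIV"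
  by (simp add: dirac_sum_def)

lemma nn_integral_dirac_sum:
  assumes "finite I" and [measurable]: "f \<in> borel_measurable borel"
  shows "(\<integral>\<^sup>+z. f z \<partial>dirac_sum I a x) = (\<Sum>i\<in>I. ennreal (a i) * f (x i))"
proof -
  have [measurable]: "x \<in> measurable (point_measure I (\<lambda>i. ennreal (a i))) borel"
    by (auto simp: measurable_def space_point_measure sets_point_measure)
  show ?thesis
    unfolding dirac_sum_def using assms(1)
    by (simp add: nn_integral_distr nn_integral_point_measure_finite)
qed

lemma prob_space_dirac_sum:
  assumes "finite I" "\<And>i. i \<in> I \<Longrightarrow> 0 \<le> a i" "sum a I = 1"
  shows "prob_space (dirac_sum I a x)"
proof
  show "emeasure (dirac_sum I a x) (space (dirac_sum I a x)) = 1"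
    using assms by (simp add: emeasure_dirac_sum)
qed

text \<open>Entries outside \<open>I \<times> J\<close> are left free, so a matrix counts only
  through its restriction to that grid.\<close>

definition transport_matrices :: "'i set \<Rightarrow> 'j set \<Rightarrow> ('i \<Rightarrow> real) \<Rightarrow> ('j \<Rightarrow> real) \<Rightarrow> ('i \<times> 'j \<Rightarrow> real) set" where
  "transport_matrices I J a b =
     {\<pi>. (\<forall>i\<in>I. \<forall>j\<in>J. 0 \<le> \<pi> (i, j)) \<and> (\<forall>i\<in>I. (\<Sum>j\<in>J. \<pi> (i, j)) = a i) \<and> (\<forall>j\<in>J. (\<Sum>i\<in>I. \<pi> (i, j)) = b j)}"

definition matrix_plan :: "'i set \<Rightarrow> 'j set \<Rightarrow> ('i \<Rightarrow> 'a::real_normed_vector) \<Rightarrow> ('j \<Rightarrow> 'a) \<Rightarrow> ('i \<times> 'j \<Rightarrow> real) \<Rightarrow> ('a \<times> 'a) measure" where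
  "matrix_plan I J x y \<pi> = dirac_sum (I \<times> J) \<pi> (\<lambda>(i, j). (x i, y j))"

definition matrix_cost :: "'i set \<Rightarrow> 'j set \<Rightarrow> ('i \<Rightarrow> 'a::real_normed_vector) \<Rightarrow> ('j \<Rightarrow> 'a) \<Rightarrow> ('i \<times> 'j \<Rightarrow> real) \<Rightarrow> real" where
  "matrix_cost I J x y \<pi> = (\<Sum>(i, j)\<in>I \<times> J. \<pi> (i, j) * (norm (x i - y j))\<^sup>2)"

lemma transport_matricesD:
  assumes "\<pi> \<in> transport_matrices I J a b"
  shows "\<And>i j. i \<in> I \<Longrightarrow> j \<in> J \<Longrightarrow> 0 \<le> \<pi> (i, j)"
    and "\<And>i. i \<in> I \<Longrightarrow> (\<Sum>j\<in>J. \<pi> (i, j)) = a i"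
    and "\<And>j. j \<in> J \<Longrightarrow> (\<Sum>i\<in>I. \<pi> (i, j)) = b j"
  using assms by (auto simp: transport_matrices_def)

text \<open>Couplings live on a product \<sigma>-algebra, matrix plans on the Borel sets of the
  product space; second countability identifies the two.\<close>

lemma sets_dirac_sum_pair:
  fixes x :: "'i \<Rightarrow> 'a::second_countable_topology" and y :: "'j \<Rightarrow> 'b::second_countable_topology"
  shows "sets (dirac_sum I a x \<Otimes>\<^sub>M dirac_sum J b y) = sets borel"
  by (simp add: borel_prod [symmetric] cong: sets_pair_measure_cong)

lemma matrix_plan_in_couplings:
  fixes x :: "'i \<Rightarrow> 'a::euclidean_space" and y :: "'j \<Rightarrow> 'a"
  assumes fin: "finite I" "finite J" and \<pi>: "\<pi> \<in> transport_matrices I J a b"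
  shows "matrix_plan I J x y \<pi> \<in> couplings (dirac_sum I a x) (dirac_sum J b y)"
proof -
  note \<pi>' = transport_matricesD [OF \<pi>]
  have "distr (matrix_plan I J x y \<pi>) (dirac_sum I a x) fst = dirac_sum I a x" (is "?L = ?R")
  proof (rule measure_eqI)
    fix A assume "A \<in> sets ?L"
    then have A [measurable]: "A \<in> sets borel" by simp
    have "emeasure ?L A = (\<integral>\<^sup>+z. indicator A (fst z) \<partial>matrix_plan I J x y \<pi>)"
      by (subst nn_integral_distr [of fst _ borel "indicator A", symmetric])
         (auto simp: matrix_plan_def cong: distr_cong)
    also have "\<dots> = (\<Sum>(i, j)\<in>I \<times> J. ennreal (\<pi> (i, j)) * indicator A (x i))"
      unfolding matrix_plan_def using fin
      by (subst nn_integral_dirac_sum) (simp_all add: case_prod_unfold)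
    also have "\<dots> = (\<Sum>i\<in>I. ennreal (a i) * indicator A (x i))"
      unfolding sum.cartesian_product [symmetric] sum_distrib_right [symmetric]
      by (intro sum.cong refl) (simp add: sum_ennreal \<pi>')
    also have "\<dots> = emeasure ?R A"
      using fin by (simp add: emeasure_dirac_sum)
    finally show "emeasure ?L A = emeasure ?R A" .
  qed simp
  moreover have "distr (matrix_plan I J x y \<pi>) (dirac_sum J b y) snd = dirac_sum J b y" (is "?L = ?R")
  proof (rule measure_eqI)
    fix A assume "A \<in> sets ?L"
    then have A [measurable]: "A \<in> sets borel" by simp
    have "emeasure ?L A = (\<integral>\<^sup>+z. indicator A (snd z) \<partial>matrix_plan I J x y \<pi>)"
      by (subst nn_integral_distr [of snd _ borel "indicator A", symmetric])
         (auto simp: matrix_plan_def cong: distr_cong)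
    also have "\<dots> = (\<Sum>(i, j)\<in>I \<times> J. ennreal (\<pi> (i, j)) * indicator A (y j))"
      unfolding matrix_plan_def using fin
      by (subst nn_integral_dirac_sum) (simp_all add: case_prod_unfold)
    also have "\<dots> = (\<Sum>j\<in>J. ennreal (b j) * indicator A (y j))"
      unfolding sum.cartesian_product [symmetric] sum.swap [of _ J] sum_distrib_right [symmetric]
      by (intro sum.cong refl) (simp add: sum_ennreal \<pi>')
    also have "\<dots> = emeasure ?R A"
      using fin by (simp add: emeasure_dirac_sum)
    finally show "emeasure ?L A = emeasure ?R A" .
  qed simp
  ultimately show ?thesis
    unfolding couplings_def mem_Collect_eq sets_dirac_sum_pair by (simp add: matrix_plan_def)
qed

lemma transport_cost_matrix_plan:
  fixes x :: "'i \<Rightarrow> 'a::euclidean_space" and y :: "'j \<Rightarrow> 'a"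
  assumes fin: "finite I" "finite J" and \<pi>: "\<pi> \<in> transport_matrices I J a b"
  shows "transport_cost (matrix_plan I J x y \<pi>) = ennreal (matrix_cost I J x y \<pi>)"
proof -
  note \<pi>' = transport_matricesD [OF \<pi>]
  have "transport_cost (matrix_plan I J x y \<pi>) = (\<Sum>k\<in>I \<times> J. ennreal (\<pi> k) * ennreal ((norm (x (fst k) - y (snd k)))\<^sup>2))"
    unfolding transport_cost_def matrix_plan_def using fin
    by (subst nn_integral_dirac_sum) (simp_all add: case_prod_unfold)
  also have "\<dots> = (\<Sum>k\<in>I \<times> J. ennreal (\<pi> k * (norm (x (fst k) - y (snd k)))\<^sup>2))"
    using \<pi>' by (intro sum.cong) (auto simp: ennreal_mult)
  also have "\<dots> = ennreal (matrix_cost I J x y \<pi>)"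
    unfolding matrix_cost_def using \<pi>' by (subst sum_ennreal) (auto simp: case_prod_unfold)
  finally show ?thesis .
qed

lemma matrix_cost_nonneg:
  assumes "\<pi> \<in> transport_matrices I J a b"
  shows "0 \<le> matrix_cost I J x y \<pi>"
  using transport_matricesD [OF assms] by (auto simp: matrix_cost_def intro!: sum_nonneg)

text \<open>The marginals charge only finitely many points, so a coupling lives on the finite grid
  of pairs \<open>(x i, y j)\<close> and is determined by its atoms. Injectivity of \<open>x\<close>
  and \<open>y\<close> keeps atoms of different index pairs apart. With
  \<open>matrix_plan_in_couplings\<close> this turns transport between the two measures into a
  finite-dimensional linear problem.\<close>

lemma coupling_is_matrix_plan:
  fixes x :: "'i \<Rightarrow> 'a::euclidean_space" and y :: "'j \<Rightarrow> 'a"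
  assumes fin: "finite I" "finite J" and inj: "inj_on x I" "inj_on y J"
    and nonneg: "\<And>i. i \<in> I \<Longrightarrow> 0 \<le> a i" "\<And>j. j \<in> J \<Longrightarrow> 0 \<le> b j" and "sum a I = 1"
    and P: "P \<in> couplings (dirac_sum I a x) (dirac_sum J b y)"
  shows "\<exists>\<pi>\<in>transport_matrices I J a b. P = matrix_plan I J x y \<pi>"
proof -
  have sets_P [simp, measurable_cong]: "sets P = sets borel"
    using P unfolding couplings_def sets_dirac_sum_pair by simp
  then have space_P [simp]: "space P = UNIV"
    using sets_eq_imp_space_eq by force
  have [measurable]: "fst \<in> measurable P (dirac_sum I a x)" "snd \<in> measurable P (dirac_sum J b y)"
    by (simp_all add: measurable_cong_sets [OF sets_P sets_dirac_sum] measurable_fst_borel measurable_snd_borel)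
  have marg: "distr P (dirac_sum I a x) fst = dirac_sum I a x" "distr P (dirac_sum J b y) snd = dirac_sum J b y"
    using P by (simp_all add: couplings_def)
  have fst_P: "emeasure P (fst -` A) = emeasure (dirac_sum I a x) A" if "A \<in> sets borel" for A
    using that by (subst marg(1) [symmetric], subst emeasure_distr) simp_all
  have snd_P: "emeasure P (snd -` A) = emeasure (dirac_sum J b y) A" if "A \<in> sets borel" for A
    using that by (subst marg(2) [symmetric], subst emeasure_distr) simp_all
  \<comment> \<open>Total mass 1 is inherited from the first marginal.\<close>
  interpret prob_space P
  proof
    interpret M: prob_space "dirac_sum I a x"
      using fin nonneg assms by (intro prob_space_dirac_sum) auto
    show "emeasure P (space P) = 1"
      using fst_P [of UNIV] M.emeasure_space_1 by simp
  qed
  define \<pi> where "\<pi> k = measure P {(x (fst k), y (snd k))}" for k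
  let ?S = "x ` I \<times> y ` J"
  have "- x ` I \<in> sets borel"
    using fin by (intro borel_open) (auto intro: finite_imp_closed)
  then have "fst -` (- x ` I) \<in> null_sets P"
    using fin measurable_sets [OF measurable_fst_borel, of "- x ` I"]
    by (intro null_setsI) (auto simp: fst_P emeasure_dirac_sum)
  then have AE1: "AE z in P. fst z \<in> x ` I"
    by (auto dest!: AE_not_in)
  have "- y ` J \<in> sets borel"
    using fin by (intro borel_open) (auto intro: finite_imp_closed)
  then have "snd -` (- y ` J) \<in> null_sets P"
    using fin measurable_sets [OF measurable_snd_borel, of "- y ` J"]
    by (intro null_setsI) (auto simp: snd_P emeasure_dirac_sum)
  then have AE2: "AE z in P. snd z \<in> y ` J"
    by (auto dest!: AE_not_in)
  have AE_S: "AE z in P. z \<in> ?S"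
    using AE1 AE2 by eventually_elim (auto simp: mem_Times_iff)
  have *: "emeasure P A = (\<Sum>k\<in>I \<times> J. ennreal (\<pi> k) * indicator A (x (fst k), y (snd k)))"
    if A [measurable]: "A \<in> sets borel" for A
  proof -
    have "emeasure P A = emeasure P (A \<inter> ?S)"
      using fin A
      by (intro emeasure_eq_AE eventually_mono [OF AE_S]) (auto intro!: sets.Int borel_closed finite_imp_closed)
    also have "\<dots> = (\<Sum>z\<in>A \<inter> ?S. emeasure P {z})"
      using fin by (intro emeasure_eq_sum_singleton) auto
    also have "\<dots> = (\<Sum>z\<in>?S. emeasure P {z} * indicator A z)"
      using fin by (intro sum.mono_neutral_cong_left) (auto simp: indicator_def)
    \<comment> \<open>Passing from grid points to index pairs is a reindexing along an injective
      map.\<close>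
    also have "?S = (\<lambda>k. (x (fst k), y (snd k))) ` (I \<times> J)"
      by force
    also have "(\<Sum>z\<in>\<dots>. emeasure P {z} * indicator A z) = (\<Sum>k\<in>I \<times> J. ennreal (\<pi> k) * indicator A (x (fst k), y (snd k)))"
      using inj by (subst sum.reindex) (auto simp: \<pi>_def emeasure_eq_measure inj_on_def)
    finally show ?thesis .
  qed
  have "\<pi> \<in> transport_matrices I J a b"
  proof -
    have "(\<Sum>j\<in>J. \<pi> (i, j)) = a i" if i: "i \<in> I" for i
    proof -
      \<comment> \<open>Testing the marginal on one atom isolates one row, because no other index
        has the same point.\<close>
      have "ennreal (a i) = emeasure (dirac_sum I a x) {x i}"
        using fin i inj by (auto simp: emeasure_dirac_sum indicator_def inj_on_eq_iff [OF inj(1)]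
            if_distrib [of "\<lambda>u. _ * u"] sum.delta cong: if_cong)
      also have "\<dots> = emeasure P (fst -` {x i})"
        by (simp add: fst_P)
      also have "\<dots> = (\<Sum>k\<in>I \<times> J. ennreal (\<pi> k) * indicator {x i} (x (fst k)))"
        using measurable_sets [OF measurable_fst_borel, of "{x i}"] by (subst *) (simp_all add: indicator_def)
      also have "\<dots> = (\<Sum>k\<in>{i} \<times> J. ennreal (\<pi> k))"
        using fin i by (intro sum.mono_neutral_cong_right) (auto simp: indicator_def inj_on_eq_iff [OF inj(1)])
      also have "\<dots> = ennreal (\<Sum>j\<in>J. \<pi> (i, j))"
        by (subst sum_ennreal) (auto simp: \<pi>_def sum.cartesian_product')
      finally show ?thesis
        using nonneg i by (subst (asm) ennreal_inj) (auto simp: \<pi>_def intro!: sum_nonneg)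
    qed
    moreover have "(\<Sum>i\<in>I. \<pi> (i, j)) = b j" if j: "j \<in> J" for j
    proof -
      have "ennreal (b j) = emeasure (dirac_sum J b y) {y j}"
        using fin j inj by (auto simp: emeasure_dirac_sum indicator_def inj_on_eq_iff [OF inj(2)]
            if_distrib [of "\<lambda>u. _ * u"] sum.delta cong: if_cong)
      also have "\<dots> = emeasure P (snd -` {y j})"
        by (simp add: snd_P)
      also have "\<dots> = (\<Sum>k\<in>I \<times> J. ennreal (\<pi> k) * indicator {y j} (y (snd k)))"
        using measurable_sets [OF measurable_snd_borel, of "{y j}"] by (subst *) (simp_all add: indicator_def)
      also have "\<dots> = (\<Sum>k\<in>I \<times> {j}. ennreal (\<pi> k))"
        using fin j by (intro sum.mono_neutral_cong_right) (auto simp: indicator_def inj_on_eq_iff [OF inj(2)])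
      also have "\<dots> = ennreal (\<Sum>i\<in>I. \<pi> (i, j))"
        by (subst sum_ennreal) (auto simp: \<pi>_def sum.cartesian_product')
      finally show ?thesis
        using nonneg j by (subst (asm) ennreal_inj) (auto simp: \<pi>_def intro!: sum_nonneg)
    qed
    ultimately show ?thesis
      by (auto simp: transport_matrices_def \<pi>_def)
  qed
  moreover have "P = matrix_plan I J x y \<pi>"
  proof (rule measure_eqI)
    fix A assume "A \<in> sets P"
    then show "emeasure P A = emeasure (matrix_plan I J x y \<pi>) A"
      using fin by (auto simp: * matrix_plan_def emeasure_dirac_sum case_prod_unfold)
  qed (simp add: matrix_plan_def)
  ultimately show ?thesis
    by blast
qed

section \<open>Existence of a cheapest transport matrix\<close>

lemma transport_matrices_sum:
  assumes "\<pi> \<in> transport_matrices I J a b"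
  shows "(\<Sum>k\<in>I \<times> J. \<pi> k) = sum a I"
  using transport_matricesD(2) [OF assms] by (simp add: sum.cartesian_product')

lemma transport_matrices_le:
  assumes fin: "finite J" and \<pi>: "\<pi> \<in> transport_matrices I J a b" and ij: "i \<in> I" "j \<in> J"
  shows "\<pi> (i, j) \<le> a i"
  using member_le_sum [of j J "\<lambda>j. \<pi> (i, j)"] transport_matricesD [OF \<pi>] fin ij by auto

text \<open>A continuous cost attains its minimum on a compact set. Since entries off the grid are
  free, the minimum is taken over the matrices that vanish there.\<close>

lemma matrix_cost_minimizer:
  fixes x :: "'i \<Rightarrow> 'a::real_normed_vector" and y :: "'j \<Rightarrow> 'a"
  assumes fin: "finite I" "finite J"
    and nonneg: "\<And>i. i \<in> I \<Longrightarrow> 0 \<le> a i" "\<And>j. j \<in> J \<Longrightarrow> 0 \<le> b j"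
    and sums: "sum a I = 1" "sum b J = 1"
  shows "\<exists>\<pi>\<in>transport_matrices I J a b. \<forall>\<rho>\<in>transport_matrices I J a b. matrix_cost I J x y \<pi> \<le> matrix_cost I J x y \<rho>"
proof -
  \<comment> \<open>Each grid entry is bounded by its row sum and every other entry is pinned to 0,
    so Tychonoff's theorem makes this box compact even when the index types are infinite.\<close>
  let ?K = "PiE UNIV (\<lambda>k. if k \<in> I \<times> J then {0..a (fst k)} else {0}) :: ('i \<times> 'j \<Rightarrow> real) set"
  define T where "T = ?K \<inter> ((\<Inter>i\<in>I. {\<pi>. (\<Sum>j\<in>J. \<pi> (i, j)) = a i}) \<inter> (\<Inter>j\<in>J. {\<pi>. (\<Sum>i\<in>I. \<pi> (i, j)) = b j}))"
  define r :: "('i \<times> 'j \<Rightarrow> real) \<Rightarrow> 'i \<times> 'j \<Rightarrow> real" where "r \<pi> = (\<lambda>k. if k \<in> I \<times> J then \<pi> k else 0)" for \<pi>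
  have "compactin (product_topology (\<lambda>_. euclidean) UNIV) ?K"
    by (subst compactin_PiE) auto
  then have "compact ?K"
    by (simp add: euclidean_product_topology)
  then have "compact T"
    unfolding T_def
    by (intro compact_Int_closed closed_Int closed_INT ballI closed_Collect_eq continuous_on_sum
        continuous_on_product_coordinates continuous_on_const) auto
  have T: "T \<subseteq> transport_matrices I J a b"
    by (auto simp: T_def transport_matrices_def PiE_iff split: if_splits)
  have r: "r \<pi> \<in> T" if "\<pi> \<in> transport_matrices I J a b" for \<pi>
    using transport_matrices_le [OF fin(2) that] transport_matricesD [OF that]
    by (auto simp: T_def r_def PiE_iff)
  \<comment> \<open>The independent coupling shows that the feasible set is nonempty.\<close>
  have "(\<lambda>(i, j). a i * b j) \<in> transport_matrices I J a b"
    using nonneg sums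
    by (simp add: transport_matrices_def sum_distrib_left [symmetric] sum_distrib_right [symmetric])
  with r have "T \<noteq> {}"
    by blast
  moreover have "continuous_on T (matrix_cost I J x y)"
    unfolding matrix_cost_def case_prod_unfold
    by (intro continuous_on_sum continuous_on_mult continuous_on_const
          continuous_on_subset [OF continuous_on_product_coordinates]) auto
  ultimately obtain \<pi> where \<pi>: "\<pi> \<in> T" "\<And>\<rho>. \<rho> \<in> T \<Longrightarrow> matrix_cost I J x y \<pi> \<le> matrix_cost I J x y \<rho>"
    using continuous_attains_inf [of T "matrix_cost I J x y"] \<open>compact T\<close> by blast
  have "matrix_cost I J x y \<pi> \<le> matrix_cost I J x y \<rho>" if "\<rho> \<in> transport_matrices I J a b" for \<rho>
  proof -
    \<comment> \<open>Truncation by \<open>r\<close> alters only entries that the cost does not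
      see.\<close>
    have "matrix_cost I J x y (r \<rho>) = matrix_cost I J x y \<rho>"
      unfolding matrix_cost_def by (intro sum.cong) (auto simp: r_def)
    with \<pi>(2) [OF r [OF that]] show ?thesis
      by simp
  qed
  with \<pi>(1) T show ?thesis
    by blast
qed

section \<open>Couplings with tilted noise\<close>

text \<open>The measure is the sum over \<open>k\<close> of the images under \<open>F k\<close> of
  \<open>N\<close> with density \<open>D k\<close>. It is built in one piece, as an image of a
  weighted product of counting measure with \<open>N\<close>; the integral formula is all that is
  used of it later.\<close>

lemma finite_mixture_exists:
  assumes "finite K" and N: "sigma_finite_measure N"
    and D: "\<And>k. k \<in> K \<Longrightarrow> D k \<in> borel_measurable N"
    and F: "\<And>k. k \<in> K \<Longrightarrow> F k \<in> measurable N L"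
  obtains P where "sets P = sets L"
    "\<And>f. f \<in> borel_measurable L \<Longrightarrow>
       (\<integral>\<^sup>+z. f z \<partial>P) = (\<Sum>k\<in>K. \<integral>\<^sup>+\<omega>. D k \<omega> * f (F k \<omega>) \<partial>N)"
proof
  interpret N: sigma_finite_measure N by fact
  let ?M = "count_space K \<Otimes>\<^sub>M N"
  let ?P = "distr (density ?M (\<lambda>(k, \<omega>). D k \<omega>)) L (\<lambda>(k, \<omega>). F k \<omega>)"
  have [measurable]: "(\<lambda>(k, \<omega>). D k \<omega>) \<in> borel_measurable ?M" "(\<lambda>(k, \<omega>). F k \<omega>) \<in> measurable ?M L"
    using assms by (auto intro!: measurable_pair_measure_countable1 countable_finite)
  show "sets ?P = sets L"
    by simp
  fix f :: "_ \<Rightarrow> ennreal" assume [measurable]: "f \<in> borel_measurable L"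
  have "(\<integral>\<^sup>+z. f z \<partial>?P) = (\<integral>\<^sup>+u. (case u of (k, \<omega>) \<Rightarrow> D k \<omega>) * f (case u of (k, \<omega>) \<Rightarrow> F k \<omega>) \<partial>?M)"
    by (subst nn_integral_distr, simp, simp) (subst nn_integral_density, auto)
  also have "\<dots> = (\<integral>\<^sup>+k. \<integral>\<^sup>+\<omega>. D k \<omega> * f (F k \<omega>) \<partial>N \<partial>count_space K)"
    by (subst N.nn_integral_fst [symmetric]) auto
  also have "\<dots> = (\<Sum>k\<in>K. \<integral>\<^sup>+\<omega>. D k \<omega> * f (F k \<omega>) \<partial>N)"
    using assms by (simp add: nn_integral_count_space_finite)
  finally show "(\<integral>\<^sup>+z. f z \<partial>?P) = (\<Sum>k\<in>K. \<integral>\<^sup>+\<omega>. D k \<omega> * f (F k \<omega>) \<partial>N)" .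
qed

lemma emeasure_dirac_sum_convolution:
  fixes x :: "'i \<Rightarrow> 'a::ordered_euclidean_space"
  assumes "finite I" "\<And>i. i \<in> I \<Longrightarrow> 0 \<le> a i" "sum a I = 1"
    and G: "prob_space G" "sets G = sets borel" and [measurable]: "A \<in> sets borel"
  shows "emeasure (dirac_sum I a x \<star> G) A = (\<Sum>i\<in>I. ennreal (a i) * (\<integral>\<^sup>+z. indicator A (x i + z) \<partial>G))"
proof -
  interpret G: prob_space G by fact
  interpret M: prob_space "dirac_sum I a x"
    using assms by (intro prob_space_dirac_sum) auto
  note [measurable_cong] = G(2)
  have "emeasure (dirac_sum I a x \<star> G) A = (\<integral>\<^sup>+u. \<integral>\<^sup>+z. indicator A (u + z) \<partial>G \<partial>dirac_sum I a x)"
    using G by (subst convolution_emeasure') (auto simp: G.finite_measure_axioms M.finite_measure_axioms)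
  also have "\<dots> = (\<Sum>i\<in>I. ennreal (a i) * (\<integral>\<^sup>+z. indicator A (x i + z) \<partial>G))"
    using assms(1) by (subst nn_integral_dirac_sum) auto
  finally show ?thesis .
qed

text \<open>The coupling behind this bound sends the source noise \<open>z\<close> at \<open>x i\<close> to \<open>y j\<close> with weight
  \<open>\<pi> (i, j) + \<gamma> (i, j) * s z\<close> and puts independent noise \<open>z'\<close> on the target.\<close>

lemma W2_sq_convolution_le_tilted:
  fixes x :: "'i \<Rightarrow> 'a::ordered_euclidean_space" and y :: "'j \<Rightarrow> 'a"
  assumes fin: "finite I" "finite J"
    and nonneg: "\<And>i. i \<in> I \<Longrightarrow> 0 \<le> a i" "\<And>j. j \<in> J \<Longrightarrow> 0 \<le> b j"
    and sums: "sum a I = 1" "sum b J = 1"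
    and G: "prob_space G" "sets G = sets borel"
    and [measurable]: "s \<in> borel_measurable borel"
    and s: "\<And>z. \<bar>s z\<bar> \<le> 1" "(\<integral>z. s z \<partial>G) = 0"
    and \<pi>: "\<pi> \<in> transport_matrices I J a b"
    and \<gamma>: "\<And>k. k \<in> I \<times> J \<Longrightarrow> \<bar>\<gamma> k\<bar> \<le> \<pi> k" "\<And>i. i \<in> I \<Longrightarrow> (\<Sum>j\<in>J. \<gamma> (i, j)) = 0"
  shows "W2_sq (dirac_sum I a x \<star> G) (dirac_sum J b y \<star> G)
      \<le> (\<Sum>(i, j)\<in>I \<times> J. \<integral>\<^sup>+z. \<integral>\<^sup>+z'. ennreal ((\<pi> (i, j) + \<gamma> (i, j) * s z) * (norm (x i + z - (y j + z')))\<^sup>2) \<partial>G \<partial>G)"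
proof -
  interpret G: prob_space G by fact
  interpret GG: pair_prob_space G G ..
  note [measurable_cong] = G(2)
  note \<pi>' = transport_matricesD [OF \<pi>]
  define D where "D = (\<lambda>k (z::'a, z'::'a). ennreal (\<pi> k + \<gamma> k * s z))"
  define F where "F = (\<lambda>k (z, z'). (x (fst k) + z, y (snd k) + z'))"
  \<comment> \<open>The tilt never exceeds the mass it modifies, so the weights are genuine
    densities.\<close>
  have weight_nonneg: "0 \<le> \<pi> k + \<gamma> k * s z" if "k \<in> I \<times> J" for k z
  proof -
    have "\<bar>\<gamma> k * s z\<bar> \<le> \<bar>\<gamma> k\<bar> * 1"
      unfolding abs_mult using s by (intro mult_left_mono) auto
    with \<gamma>(1) [OF that] show ?thesis
      by linarith
  qed
  obtain P where P: "sets P = sets (borel \<Otimes>\<^sub>M borel)"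
    "\<And>f. f \<in> borel_measurable (borel \<Otimes>\<^sub>M borel) \<Longrightarrow>
       (\<integral>\<^sup>+z. f z \<partial>P) = (\<Sum>k\<in>I \<times> J. \<integral>\<^sup>+\<omega>. D k \<omega> * f (F k \<omega>) \<partial>(G \<Otimes>\<^sub>M G))"
  proof (rule finite_mixture_exists [where K = "I \<times> J" and N = "G \<Otimes>\<^sub>M G" and D = D and F = F and L = "borel \<Otimes>\<^sub>M borel"])
    show "finite (I \<times> J)"
      using fin by simp
    show "sigma_finite_measure (G \<Otimes>\<^sub>M G)" ..
    show "D k \<in> borel_measurable (G \<Otimes>\<^sub>M G)" for k
      unfolding D_def by measurable
    show "F k \<in> measurable (G \<Otimes>\<^sub>M G) (borel \<Otimes>\<^sub>M borel)" for k
      unfolding F_def by measurable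
  qed blast
  note [measurable_cong] = P(1)
  have nn_P: "(\<integral>\<^sup>+u. f u \<partial>P) = (\<Sum>k\<in>I \<times> J. \<integral>\<^sup>+z. \<integral>\<^sup>+z'. ennreal (\<pi> k + \<gamma> k * s z) * f (x (fst k) + z, y (snd k) + z') \<partial>G \<partial>G)"
    if [measurable]: "f \<in> borel_measurable (borel \<Otimes>\<^sub>M borel)" for f
  proof -
    have "(\<integral>\<^sup>+\<omega>. D k \<omega> * f (F k \<omega>) \<partial>(G \<Otimes>\<^sub>M G))
        = (\<integral>\<^sup>+z. \<integral>\<^sup>+z'. ennreal (\<pi> k + \<gamma> k * s z) * f (x (fst k) + z, y (snd k) + z') \<partial>G \<partial>G)" for k
      unfolding D_def F_def by (subst G.nn_integral_fst [symmetric]) auto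
    then show ?thesis
      using P(2) [OF that] by simp
  qed
  \<comment> \<open>First marginal: the rows of \<open>\<gamma>\<close> sum to 0, so for each fixed
    source noise \<open>z\<close> the weights out of \<open>x i\<close> still add up to
    \<open>a i\<close>.\<close>
  have "distr P borel fst = (dirac_sum I a x \<star> G)" (is "?L = ?R")
  proof (rule measure_eqI)
    fix A assume "A \<in> sets ?L"
    then have A [measurable]: "A \<in> sets borel" by simp
    have "emeasure ?L A = (\<integral>\<^sup>+u. indicator A (fst u) \<partial>P)"
      by (subst nn_integral_distr [of fst _ borel "indicator A", symmetric]) auto
    also have "\<dots> = (\<Sum>k\<in>I \<times> J. \<integral>\<^sup>+z. ennreal (\<pi> k + \<gamma> k * s z) * indicator A (x (fst k) + z) \<partial>G)"
      by (subst nn_P) (simp_all add: G.emeasure_space_1)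
    also have "\<dots> = (\<Sum>i\<in>I. \<integral>\<^sup>+z. (\<Sum>j\<in>J. ennreal (\<pi> (i, j) + \<gamma> (i, j) * s z)) * indicator A (x i + z) \<partial>G)"
      by (simp add: sum.cartesian_product' sum_distrib_right nn_integral_sum)
    also have "\<dots> = (\<Sum>i\<in>I. \<integral>\<^sup>+z. ennreal (a i) * indicator A (x i + z) \<partial>G)"
    proof (intro sum.cong refl)
      fix i assume i: "i \<in> I"
      have "(\<Sum>j\<in>J. ennreal (\<pi> (i, j) + \<gamma> (i, j) * s z)) = ennreal (a i)" for z
        using i by (subst sum_ennreal)
          (auto simp: weight_nonneg sum.distrib \<pi>' \<gamma>(2) sum_distrib_right [symmetric])
      then show "(\<integral>\<^sup>+z. (\<Sum>j\<in>J. ennreal (\<pi> (i, j) + \<gamma> (i, j) * s z)) * indicator A (x i + z) \<partial>G)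
          = (\<integral>\<^sup>+z. ennreal (a i) * indicator A (x i + z) \<partial>G)"
        by simp
    qed
    also have "\<dots> = emeasure ?R A"
      using fin nonneg sums G A by (simp add: emeasure_dirac_sum_convolution nn_integral_cmult)
    finally show "emeasure ?L A = emeasure ?R A" .
  qed simp
  moreover have "distr P borel snd = (dirac_sum J b y \<star> G)" (is "?L = ?R")
  proof (rule measure_eqI)
    fix A assume "A \<in> sets ?L"
    then have A [measurable]: "A \<in> sets borel" by simp
    have int_s: "integrable G s"
      using s by (intro G.integrable_const_bound [of _ 1]) auto
    \<comment> \<open>Second marginal: the target noise is independent of \<open>z\<close>, so only
      the average weight over \<open>z\<close> matters, and the mean-zero \<open>s\<close> removes
      the tilt from it.\<close>
    have weight: "(\<integral>\<^sup>+z. ennreal (\<pi> k + \<gamma> k * s z) \<partial>G) = ennreal (\<pi> k)" if "k \<in> I \<times> J" for k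
      using int_s s(2) weight_nonneg [OF that] G.prob_space
      by (subst nn_integral_eq_integral) auto
    have "emeasure ?L A = (\<integral>\<^sup>+u. indicator A (snd u) \<partial>P)"
      by (subst nn_integral_distr [of snd _ borel "indicator A", symmetric]) auto
    also have "\<dots> = (\<Sum>k\<in>I \<times> J. (\<integral>\<^sup>+z. ennreal (\<pi> k + \<gamma> k * s z) \<partial>G) * (\<integral>\<^sup>+z'. indicator A (y (snd k) + z') \<partial>G))"
      by (subst nn_P) (simp_all add: nn_integral_cmult nn_integral_multc)
    also have "\<dots> = (\<Sum>k\<in>I \<times> J. ennreal (\<pi> k) * (\<integral>\<^sup>+z'. indicator A (y (snd k) + z') \<partial>G))"
      by (intro sum.cong) (auto simp: weight)
    also have "\<dots> = (\<Sum>j\<in>J. (\<Sum>i\<in>I. ennreal (\<pi> (i, j))) * (\<integral>\<^sup>+z'. indicator A (y j + z') \<partial>G))"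
      unfolding sum.cartesian_product' by (subst sum.swap) (simp add: sum_distrib_right)
    also have "\<dots> = emeasure ?R A"
      using fin nonneg sums G A
      by (subst emeasure_dirac_sum_convolution) (auto intro!: sum.cong simp: sum_ennreal \<pi>')
    finally show "emeasure ?L A = emeasure ?R A" .
  qed simp
  ultimately have "P \<in> couplings (dirac_sum I a x \<star> G) (dirac_sum J b y \<star> G)"
    using P(1) by (simp add: couplings_def cong: sets_pair_measure_cong distr_cong)
  then have "W2_sq (dirac_sum I a x \<star> G) (dirac_sum J b y \<star> G) \<le> transport_cost P"
    unfolding W2_sq_def by (rule INF_lower)
  also have "\<dots> = (\<Sum>k\<in>I \<times> J. \<integral>\<^sup>+z. \<integral>\<^sup>+z'. ennreal (\<pi> k + \<gamma> k * s z) *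
      ennreal ((norm (x (fst k) + z - (y (snd k) + z')))\<^sup>2) \<partial>G \<partial>G)"
    unfolding transport_cost_def by (subst nn_P) simp_all
  also have "\<dots> = (\<Sum>(i, j)\<in>I \<times> J. \<integral>\<^sup>+z. \<integral>\<^sup>+z'. ennreal ((\<pi> (i, j) + \<gamma> (i, j) * s z) * (norm (x i + z - (y j + z')))\<^sup>2) \<partial>G \<partial>G)"
    by (intro sum.cong nn_integral_cong) (auto simp: ennreal_mult weight_nonneg)
  finally show ?thesis .
qed

section \<open>Cost of the tilted coupling\<close>

lemma integral_odd_eq_0:
  fixes f :: "'a::euclidean_space \<Rightarrow> real"
  assumes G: "distr G borel uminus = G" and [measurable]: "f \<in> borel_measurable borel"
    and odd: "\<And>z. f (- z) = - f z"
  shows "(\<integral>z. f z \<partial>G) = 0"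
proof -
  have [measurable_cong]: "sets G = sets borel"
    by (subst G [symmetric]) simp
  have "(\<integral>z. f z \<partial>G) = (\<integral>z. f (- z) \<partial>G)"
    by (subst G [symmetric], subst integral_distr) auto
  then show ?thesis
    by (simp add: odd)
qed

text \<open>Expand the squared norm around \<open>u\<close>. The linear term in \<open>z'\<close>
  averages to 0, while the linear term in \<open>z\<close> survives only through its correlation
  with the tilt. The weight is at most \<open>2 * p\<close> and the squared norm of
  \<open>z - z'\<close> is at most twice the sum of the two squared norms, which gives the constant
  \<open>8 * p\<close>. Nonnegativity of the bound is recorded so that bounds in
  \<open>ennreal\<close> can be added as reals.\<close>

lemma nn_integral_tilted_cost_le:
  fixes u :: "'a::euclidean_space"
  assumes G: "prob_space G" "distr G borel uminus = G" "integrable G (\<lambda>z. (norm z)\<^sup>2)"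
    and [measurable]: "s \<in> borel_measurable borel"
    and s: "\<And>z. \<bar>s z\<bar> \<le> 1" "(\<integral>z. s z \<partial>G) = 0"
    and g: "\<bar>g\<bar> \<le> p"
  shows "0 \<le> p * (norm u)\<^sup>2 + 2 * g * (\<integral>z. s z * (u \<bullet> z) \<partial>G) + 8 * p * (\<integral>z. (norm z)\<^sup>2 \<partial>G)"
    and "(\<integral>\<^sup>+z. \<integral>\<^sup>+z'. ennreal ((p + g * s z) * (norm (u + z - z'))\<^sup>2) \<partial>G \<partial>G)
       \<le> ennreal (p * (norm u)\<^sup>2 + 2 * g * (\<integral>z. s z * (u \<bullet> z) \<partial>G) + 8 * p * (\<integral>z. (norm z)\<^sup>2 \<partial>G))"
proof -
  interpret G: prob_space G by fact
  have sets_G [measurable_cong]: "sets G = sets borel"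
    by (subst G(2) [symmetric]) simp
  let ?M = "\<integral>z. (norm z)\<^sup>2 \<partial>G"
  have int_abs: "integrable G (\<lambda>z. \<bar>z \<bullet> u\<bar>)"
    using G sets_G by (intro integrable_abs_inner) (auto simp: G.finite_measure_axioms)
  have int_u: "integrable G (\<lambda>z. u \<bullet> z)"
    using integrable_abs_cancel [OF int_abs] by (simp add: inner_commute)
  have int_su: "integrable G (\<lambda>z. s z * (u \<bullet> z))"
  proof (rule Bochner_Integration.integrable_bound [OF int_abs])
    show "AE z in G. norm (s z * (u \<bullet> z)) \<le> norm \<bar>z \<bullet> u\<bar>"
      using s by (auto simp: abs_mult inner_commute mult_left_le_one_le)
  qed measurable
  have int_s: "integrable G s"
    using s by (intro G.integrable_const_bound [of _ 1]) auto
  have mean_u: "(\<integral>z. u \<bullet> z \<partial>G) = 0"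
    using G(2) by (intro integral_odd_eq_0) auto
  have weight: "0 \<le> p + g * s z" "p + g * s z \<le> 2 * p" for z
  proof -
    have "\<bar>g * s z\<bar> \<le> \<bar>g\<bar> * 1"
      unfolding abs_mult using s by (intro mult_left_mono) auto
    with g show "0 \<le> p + g * s z" "p + g * s z \<le> 2 * p"
      by linarith+
  qed
  \<comment> \<open>\<open>q\<close> keeps the constant and linear terms exactly and majorises only
    the quadratic noise term; \<open>h\<close> is its average over \<open>z'\<close>.\<close>
  define q where "q z z' = (p + g * s z) * ((norm u)\<^sup>2 + 2 * (u \<bullet> z) - 2 * (u \<bullet> z')) + 4 * p * ((norm z)\<^sup>2 + (norm z')\<^sup>2)" for z z'
  define h where "h z = (p + g * s z) * ((norm u)\<^sup>2 + 2 * (u \<bullet> z)) + 4 * p * ((norm z)\<^sup>2 + ?M)" for z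
  have le_q: "(p + g * s z) * (norm (u + z - z'))\<^sup>2 \<le> q z z'" for z z'
  proof -
    have "(norm (z - z'))\<^sup>2 \<le> (norm z + norm z')\<^sup>2"
      by (intro power_mono norm_triangle_ineq4) auto
    also have "\<dots> \<le> 2 * ((norm z)\<^sup>2 + (norm z')\<^sup>2)"
      using sum_squares_bound [of "norm z" "norm z'"] by (simp add: power2_sum)
    finally have 1: "(norm (z - z'))\<^sup>2 \<le> 2 * ((norm z)\<^sup>2 + (norm z')\<^sup>2)" .
    have "(p + g * s z) * (norm (z - z'))\<^sup>2 \<le> (2 * p) * (2 * ((norm z)\<^sup>2 + (norm z')\<^sup>2))"
      using weight [of z] g by (intro mult_mono 1) auto
    moreover have "(norm (u + z - z'))\<^sup>2 = (norm u)\<^sup>2 + 2 * (u \<bullet> z) - 2 * (u \<bullet> z') + (norm (z - z'))\<^sup>2"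
      by (simp add: power2_norm_eq_inner inner_diff_left inner_diff_right inner_add_left inner_add_right inner_commute algebra_simps)
    ultimately show ?thesis
      unfolding q_def by (simp add: distrib_left)
  qed
  have q_nonneg: "0 \<le> q z z'" for z z'
    using weight [of z] by (intro order_trans [OF _ le_q]) auto
  have int_q: "integrable G (q z)" "(\<integral>z'. q z z' \<partial>G) = h z" for z
    unfolding q_def h_def using int_u mean_u G(3) G.prob_space by (auto simp: algebra_simps)
  have h_nonneg: "0 \<le> h z" for z
    unfolding int_q(2) [symmetric] by (intro Bochner_Integration.integral_nonneg q_nonneg)
  \<comment> \<open>Expanded so that each summand is integrable; those with
    \<open>u \<bullet> z\<close> or \<open>s z\<close> alone have mean zero.\<close>
  have h_eq: "h = (\<lambda>z. p * (norm u)\<^sup>2 + 2 * p * (u \<bullet> z) + g * (norm u)\<^sup>2 * s z + 2 * g * (s z * (u \<bullet> z)) + 4 * p * (norm z)\<^sup>2 + 4 * p * ?M)"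
    by (simp add: h_def fun_eq_iff algebra_simps)
  have int_h: "integrable G h"
    unfolding h_eq using int_u int_s int_su G(3) by (intro Bochner_Integration.integrable_add integrable_mult_right) auto
  have integral_h: "(\<integral>z. h z \<partial>G) = p * (norm u)\<^sup>2 + 2 * g * (\<integral>z. s z * (u \<bullet> z) \<partial>G) + 8 * p * ?M"
    unfolding h_eq using int_u int_s int_su G(3) mean_u s(2) G.prob_space by simp
  show "0 \<le> p * (norm u)\<^sup>2 + 2 * g * (\<integral>z. s z * (u \<bullet> z) \<partial>G) + 8 * p * ?M"
    unfolding integral_h [symmetric] by (intro Bochner_Integration.integral_nonneg h_nonneg)
  have "(\<integral>\<^sup>+z. \<integral>\<^sup>+z'. ennreal ((p + g * s z) * (norm (u + z - z'))\<^sup>2) \<partial>G \<partial>G) \<le> (\<integral>\<^sup>+z. \<integral>\<^sup>+z'. ennreal (q z z') \<partial>G \<partial>G)"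
    by (intro nn_integral_mono ennreal_leI le_q)
  also have "\<dots> = (\<integral>\<^sup>+z. ennreal (h z) \<partial>G)"
    by (intro nn_integral_cong) (simp add: nn_integral_eq_integral int_q q_nonneg)
  also have "\<dots> = ennreal (\<integral>z. h z \<partial>G)"
    by (intro nn_integral_eq_integral int_h) (simp add: h_nonneg)
  finally show "(\<integral>\<^sup>+z. \<integral>\<^sup>+z'. ennreal ((p + g * s z) * (norm (u + z - z'))\<^sup>2) \<partial>G \<partial>G)
       \<le> ennreal (p * (norm u)\<^sup>2 + 2 * g * (\<integral>z. s z * (u \<bullet> z) \<partial>G) + 8 * p * ?M)"
    unfolding integral_h .
qed

text \<open>Row \<open>i\<close> can trade mass \<open>t\<close> between \<open>y j\<close> and
  \<open>y j'\<close> according to the side on which the noise falls. The gain is of first order in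
  the noise; the quadratic terms sum to 8 second moments because \<open>\<pi>\<close> has total mass
  1.\<close>

lemma W2_sq_convolution_le_split:
  fixes x :: "'i \<Rightarrow> 'a::ordered_euclidean_space" and y :: "'j \<Rightarrow> 'a"
  assumes fin: "finite I" "finite J"
    and nonneg: "\<And>i. i \<in> I \<Longrightarrow> 0 \<le> a i" "\<And>j. j \<in> J \<Longrightarrow> 0 \<le> b j"
    and sums: "sum a I = 1" "sum b J = 1"
    and G: "prob_space G" "distr G borel uminus = G" "integrable G (\<lambda>z. (norm z)\<^sup>2)"
    and \<pi>: "\<pi> \<in> transport_matrices I J a b"
    and split: "i \<in> I" "j \<in> J" "j' \<in> J" "j \<noteq> j'" "0 \<le> t" "t \<le> \<pi> (i, j)" "t \<le> \<pi> (i, j')"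
  shows "enn2real (W2_sq (dirac_sum I a x \<star> G) (dirac_sum J b y \<star> G))
      \<le> matrix_cost I J x y \<pi> - 2 * t * (\<integral>z. \<bar>z \<bullet> (y j - y j')\<bar> \<partial>G) + 8 * (\<integral>z. (norm z)\<^sup>2 \<partial>G)"
proof -
  interpret G: prob_space G by fact
  have sets_G [measurable_cong]: "sets G = sets borel"
    by (subst G(2) [symmetric]) simp
  note \<pi>' = transport_matricesD [OF \<pi>]
  \<comment> \<open>The sign is the best bounded tilt: it turns the correlation with
    \<open>y j - y j'\<close> into a first absolute moment. The two opposite entries of
    \<open>\<gamma>\<close> cancel in the row sum, and \<open>t\<close> is at most either affected
    entry of \<open>\<pi>\<close>.\<close>
  define s where "s z = sgn (z \<bullet> (y j - y j'))" for z
  define \<gamma> where "\<gamma> = (\<lambda>k. if k = (i, j) then t else if k = (i, j') then - t else 0)"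
  define E where "E u = (\<integral>z. s z * (u \<bullet> z) \<partial>G)" for u
  have [measurable]: "s \<in> borel_measurable borel"
    unfolding s_def by measurable
  have s: "\<bar>s z\<bar> \<le> 1" for z
    by (simp add: s_def sgn_if)
  have mean_s: "(\<integral>z. s z \<partial>G) = 0"
    using G(2) by (intro integral_odd_eq_0) (auto simp: s_def sgn_minus)
  have int_su: "integrable G (\<lambda>z. s z * (u \<bullet> z))" for u
  proof (rule Bochner_Integration.integrable_bound)
    show "integrable G (\<lambda>z. \<bar>z \<bullet> u\<bar>)"
      using G sets_G by (intro integrable_abs_inner) (auto simp: G.finite_measure_axioms)
    show "AE z in G. norm (s z * (u \<bullet> z)) \<le> norm \<bar>z \<bullet> u\<bar>"
      using s by (auto simp: abs_mult inner_commute mult_left_le_one_le)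
  qed measurable
  have E_diff: "E (x i - y j) - E (x i - y j') = - (\<integral>z. \<bar>z \<bullet> (y j - y j')\<bar> \<partial>G)"
  proof -
    \<comment> \<open>The source point cancels, leaving only the direction between the two
      targets.\<close>
    have "s z * ((x i - y j) \<bullet> z) - s z * ((x i - y j') \<bullet> z) = - \<bar>z \<bullet> (y j - y j')\<bar>" for z
      unfolding s_def abs_sgn by (simp add: inner_diff_left inner_diff_right inner_commute algebra_simps)
    then show ?thesis
      unfolding E_def by (subst Bochner_Integration.integral_diff [symmetric]) (auto simp: int_su)
  qed
  have \<gamma>: "\<bar>\<gamma> k\<bar> \<le> \<pi> k" if "k \<in> I \<times> J" for k
    using that split \<pi>' by (auto simp: \<gamma>_def)
  have \<gamma>_sum: "(\<Sum>j\<in>J. \<gamma> (i', j)) = 0" for i'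
  proof -
    have "(\<Sum>l\<in>J. \<gamma> (i', l)) = (\<Sum>l\<in>J. (if l = j then (if i' = i then t else 0) else 0)) - (\<Sum>l\<in>J. (if l = j' then (if i' = i then t else 0) else 0))"
      unfolding sum_subtractf [symmetric] using split by (intro sum.cong) (auto simp: \<gamma>_def)
    then show ?thesis
      using split fin by simp
  qed
  let ?c = "\<lambda>k. \<pi> k * (norm (x (fst k) - y (snd k)))\<^sup>2 + 2 * \<gamma> k * E (x (fst k) - y (snd k)) + 8 * \<pi> k * (\<integral>z. (norm z)\<^sup>2 \<partial>G)"
  have bound: "0 \<le> ?c k"
      "(\<integral>\<^sup>+z. \<integral>\<^sup>+z'. ennreal ((\<pi> k + \<gamma> k * s z) * (norm (x (fst k) - y (snd k) + z - z'))\<^sup>2) \<partial>G \<partial>G) \<le> ennreal (?c k)"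
    if "k \<in> I \<times> J" for k
    using nn_integral_tilted_cost_le [OF G _ s mean_s \<gamma> [OF that], of "x (fst k) - y (snd k)"]
    unfolding E_def by auto
  have "(\<Sum>k\<in>I \<times> J. 2 * \<gamma> k * E (x (fst k) - y (snd k))) = (\<Sum>k\<in>{(i, j), (i, j')}. 2 * \<gamma> k * E (x (fst k) - y (snd k)))"
    using fin split by (intro sum.mono_neutral_right) (auto simp: \<gamma>_def)
  also have "\<dots> = 2 * t * (E (x i - y j) - E (x i - y j'))"
    using split by (simp add: \<gamma>_def algebra_simps)
  finally have tilt: "(\<Sum>k\<in>I \<times> J. 2 * \<gamma> k * E (x (fst k) - y (snd k))) = - 2 * t * (\<integral>z. \<bar>z \<bullet> (y j - y j')\<bar> \<partial>G)"
    unfolding E_diff by simp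
  have sum_c: "(\<Sum>k\<in>I \<times> J. ?c k) = matrix_cost I J x y \<pi> - 2 * t * (\<integral>z. \<bar>z \<bullet> (y j - y j')\<bar> \<partial>G) + 8 * (\<integral>z. (norm z)\<^sup>2 \<partial>G)"
    unfolding sum.distrib tilt sum_distrib_right [symmetric] sum_distrib_left [symmetric]
    using transport_matrices_sum [OF \<pi>] sums by (simp add: matrix_cost_def case_prod_unfold)
  have "W2_sq (dirac_sum I a x \<star> G) (dirac_sum J b y \<star> G)
      \<le> (\<Sum>(i, j)\<in>I \<times> J. \<integral>\<^sup>+z. \<integral>\<^sup>+z'. ennreal ((\<pi> (i, j) + \<gamma> (i, j) * s z) * (norm (x i + z - (y j + z')))\<^sup>2) \<partial>G \<partial>G)"
    using W2_sq_convolution_le_tilted [OF fin nonneg sums G(1) sets_G _ s mean_s \<pi> \<gamma> \<gamma>_sum] by auto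
  also have "\<dots> \<le> (\<Sum>k\<in>I \<times> J. ennreal (?c k))"
    using bound(2) by (intro sum_mono) (auto simp: algebra_simps)
  also have "\<dots> = ennreal (\<Sum>k\<in>I \<times> J. ?c k)"
    using bound(1) by (intro sum_ennreal)
  finally show ?thesis
    unfolding sum_c [symmetric] using bound(1) by (intro enn2real_leI sum_nonneg)
qed

section \<open>Split optimal plans\<close>

text \<open>Exchanging coordinates maps couplings to couplings of equal cost. This lets a column
  split be treated as a row split.\<close>

lemma W2_sq_commute:
  fixes M N :: "'a::euclidean_space measure"
  assumes [measurable_cong]: "sets M = sets borel" "sets N = sets borel"
  shows "W2_sq M N = W2_sq N M"
proof -
  have le: "W2_sq M N \<le> W2_sq N M"
    if [measurable_cong]: "sets M = sets borel" "sets N = sets borel" for M N :: "'a measure"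
    unfolding W2_sq_def
  proof (rule INF_greatest)
    fix P assume P: "P \<in> couplings N M"
    then have [measurable_cong]: "sets P = sets (N \<Otimes>\<^sub>M M)"
      by (simp add: couplings_def)
    let ?Q = "distr P (M \<Otimes>\<^sub>M N) (\<lambda>u. (snd u, fst u))"
    have "distr ?Q M fst = distr P M snd" "distr ?Q N snd = distr P N fst"
      by (simp_all add: distr_distr comp_def)
    with P have "?Q \<in> couplings M N"
      by (simp add: couplings_def)
    moreover have "transport_cost ?Q = transport_cost P"
      unfolding transport_cost_def by (subst nn_integral_distr) (auto simp: norm_minus_commute)
    ultimately show "(INF P\<in>couplings M N. transport_cost P) \<le> transport_cost P"
      by (auto intro: INF_lower2)
  qed
  show ?thesis
    by (intro order.antisym le assms)
qed

lemma transport_matrices_swap: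
  assumes "\<pi> \<in> transport_matrices I J a b"
  shows "\<pi> \<circ> prod.swap \<in> transport_matrices J I b a"
  using assms by (auto simp: transport_matrices_def)

lemma matrix_cost_swap:
  fixes y :: "'j \<Rightarrow> 'a::real_normed_vector"
  shows "matrix_cost J I y x (\<pi> \<circ> prod.swap) = matrix_cost I J x y \<pi>"
  unfolding matrix_cost_def sum.cartesian_product [symmetric]
  by (subst sum.swap) (simp add: norm_minus_commute)

text \<open>The preceding bound gives a gain of at least
  \<open>2 * t * K * \<sigma> - 8 * M * \<sigma>\<^sup>2\<close>. For small \<sigma> the quadratic
  loss consumes at most half of the linear term, so \<open>C = t * K\<close> works.\<close>

lemma gaussian_smoothing_gain_row_split:
  fixes x :: "'i \<Rightarrow> 'a::ordered_euclidean_space" and y :: "'j \<Rightarrow> 'a"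
  assumes fin: "finite I" "finite J" and inj: "inj_on y J"
    and nonneg: "\<And>i. i \<in> I \<Longrightarrow> 0 \<le> a i" "\<And>j. j \<in> J \<Longrightarrow> 0 \<le> b j"
    and sums: "sum a I = 1" "sum b J = 1"
    and \<pi>: "\<pi> \<in> transport_matrices I J a b"
    and split: "i \<in> I" "j \<in> J" "j' \<in> J" "j \<noteq> j'" "0 < \<pi> (i, j)" "0 < \<pi> (i, j')"
  shows "\<exists>c>0. \<exists>C>0. \<forall>\<sigma>\<in>{0<..<c}. C * \<sigma> \<le> matrix_cost I J x y \<pi> -
    enn2real (W2_sq (dirac_sum I a x \<star> gaussian \<sigma>) (dirac_sum J b y \<star> gaussian \<sigma>))"
proof -
  define t where "t = min (\<pi> (i, j)) (\<pi> (i, j'))"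
  define K where "K = (\<integral>z. \<bar>z \<bullet> (y j - y j')\<bar> \<partial>gaussian 1)"
  define M where "M = (\<integral>z. (norm (z :: 'a))\<^sup>2 \<partial>gaussian 1)"
  have t: "0 < t" "t \<le> \<pi> (i, j)" "t \<le> \<pi> (i, j')"
    using split by (auto simp: t_def)
  have K: "0 < K"
    unfolding K_def using split inj by (intro gaussian_abs_inner_pos) (auto dest: inj_onD)
  have M: "0 \<le> M"
    unfolding M_def by (intro Bochner_Integration.integral_nonneg) simp
  \<comment> \<open>The threshold forces \<open>8 * M * \<sigma> \<le> t * K\<close>; adding 1 keeps
    the denominator positive even if only \<open>0 \<le> M\<close> is known.\<close>
  have gain: "t * K * \<sigma> \<le> matrix_cost I J x y \<pi> -
      enn2real (W2_sq (dirac_sum I a x \<star> gaussian \<sigma>) (dirac_sum J b y \<star> gaussian \<sigma>))"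
    if \<sigma>: "0 < \<sigma>" "\<sigma> < t * K / (8 * M + 1)" for \<sigma>
  proof -
    have K\<sigma>: "(\<integral>z. \<bar>z \<bullet> (y j - y j')\<bar> \<partial>gaussian \<sigma>) = K * \<sigma>"
      unfolding K_def using \<sigma>(1) by (subst integral_gaussian_scale) (auto simp: abs_mult)
    have M\<sigma>: "(\<integral>z. (norm (z :: 'a))\<^sup>2 \<partial>gaussian \<sigma>) = M * \<sigma>\<^sup>2"
      unfolding M_def using \<sigma>(1) by (subst integral_gaussian_scale) (auto simp: power_mult_distrib)
    have "enn2real (W2_sq (dirac_sum I a x \<star> gaussian \<sigma>) (dirac_sum J b y \<star> gaussian \<sigma>))
        \<le> matrix_cost I J x y \<pi> - 2 * t * (K * \<sigma>) + 8 * (M * \<sigma>\<^sup>2)"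
      unfolding K\<sigma> [symmetric] M\<sigma> [symmetric]
      using split t by (intro W2_sq_convolution_le_split fin nonneg sums \<pi> prob_space_gaussian
          distr_gaussian_uminus integrable_gaussian_norm_square \<sigma>(1)) auto
    moreover have "8 * (M * \<sigma>\<^sup>2) \<le> t * K * \<sigma>"
    proof -
      have "8 * M * \<sigma> \<le> (8 * M + 1) * \<sigma>"
        using \<sigma> by simp
      also have "\<dots> \<le> t * K"
        using \<sigma> M by (simp add: field_simps)
      finally show ?thesis
        using \<sigma> by (simp add: power2_eq_square mult.assoc [symmetric])
    qed
    ultimately show ?thesis
      by simp
  qed
  have "0 < t * K / (8 * M + 1)"
    using t K M by simp
  moreover have "0 < t * K"
    using t K by simp
  ultimately show ?thesis
    using gain by (meson greaterThanLessThan_iff)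
qed

section \<open>Optimal matrices and the perfect matching alternative\<close>

definition optimal_matrices :: "'i set \<Rightarrow> 'j set \<Rightarrow> ('i \<Rightarrow> real) \<Rightarrow> ('j \<Rightarrow> real) \<Rightarrow> ('i \<Rightarrow> 'a::real_normed_vector) \<Rightarrow> ('j \<Rightarrow> 'a) \<Rightarrow> ('i \<times> 'j \<Rightarrow> real) set" where
  "optimal_matrices I J a b x y =
     {\<pi> \<in> transport_matrices I J a b. \<forall>\<rho>\<in>transport_matrices I J a b. matrix_cost I J x y \<pi> \<le> matrix_cost I J x y \<rho>}"

text \<open>Feasibility is a convex condition and the cost is linear. The midpoint is positive
  wherever either matrix is, which lets a condition on single optimal matrices compare two of
  them.\<close>

lemma optimal_matrices_midpoint:
  assumes "\<pi> \<in> optimal_matrices I J a b x y" "\<rho> \<in> optimal_matrices I J a b x y"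
  shows "(\<lambda>k. (\<pi> k + \<rho> k) / 2) \<in> optimal_matrices I J a b x y"
proof -
  let ?m = "\<lambda>k. (\<pi> k + \<rho> k) / 2"
  have \<pi>: "\<pi> \<in> transport_matrices I J a b" and \<rho>: "\<rho> \<in> transport_matrices I J a b"
    using assms by (auto simp: optimal_matrices_def)
  have m: "?m \<in> transport_matrices I J a b"
    using transport_matricesD [OF \<pi>] transport_matricesD [OF \<rho>]
    by (auto simp: transport_matrices_def sum.distrib sum_divide_distrib [symmetric])
  have "matrix_cost I J x y ?m = (matrix_cost I J x y \<pi> + matrix_cost I J x y \<rho>) / 2"
    unfolding matrix_cost_def sum.distrib [symmetric] sum_divide_distrib
    by (intro sum.cong) (auto simp: field_simps)
  also have "matrix_cost I J x y \<rho> = matrix_cost I J x y \<pi>"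
    using assms \<pi> \<rho> by (intro order.antisym) (auto simp: optimal_matrices_def)
  finally have "matrix_cost I J x y ?m = matrix_cost I J x y \<pi>"
    by simp
  then show ?thesis
    using assms(1) m by (simp add: optimal_matrices_def)
qed

lemma W2_sq_dirac_sum:
  fixes x :: "'i \<Rightarrow> 'a::euclidean_space" and y :: "'j \<Rightarrow> 'a"
  assumes fin: "finite I" "finite J" and inj: "inj_on x I" "inj_on y J"
    and nonneg: "\<And>i. i \<in> I \<Longrightarrow> 0 \<le> a i" "\<And>j. j \<in> J \<Longrightarrow> 0 \<le> b j" and "sum a I = 1"
    and \<pi>: "\<pi> \<in> optimal_matrices I J a b x y"
  shows "W2_sq (dirac_sum I a x) (dirac_sum J b y) = ennreal (matrix_cost I J x y \<pi>)"
proof (rule antisym)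
  have \<pi>': "\<pi> \<in> transport_matrices I J a b"
    using \<pi> by (simp add: optimal_matrices_def)
  show "W2_sq (dirac_sum I a x) (dirac_sum J b y) \<le> ennreal (matrix_cost I J x y \<pi>)"
    unfolding W2_sq_def using fin \<pi>'
    by (intro INF_lower2 [OF matrix_plan_in_couplings]) (auto simp: transport_cost_matrix_plan)
  show "ennreal (matrix_cost I J x y \<pi>) \<le> W2_sq (dirac_sum I a x) (dirac_sum J b y)"
    unfolding W2_sq_def
  proof (rule INF_greatest)
    fix P assume "P \<in> couplings (dirac_sum I a x) (dirac_sum J b y)"
    then obtain \<rho> where \<rho>: "\<rho> \<in> transport_matrices I J a b" "P = matrix_plan I J x y \<rho>"
      using coupling_is_matrix_plan [of I J x y a b P] assms by auto
    show "ennreal (matrix_cost I J x y \<pi>) \<le> transport_cost P"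
      unfolding \<rho>(2) transport_cost_matrix_plan [OF fin \<rho>(1)]
      using \<pi> \<rho>(1) by (auto simp: optimal_matrices_def intro!: ennreal_leI)
  qed
qed

text \<open>All couplings are matrix plans and matrix costs are nonnegative, so comparing costs in
  \<open>ennreal\<close> is comparing them as reals.\<close>

lemma optimal_plans_dirac_sum:
  fixes x :: "'i \<Rightarrow> 'a::euclidean_space" and y :: "'j \<Rightarrow> 'a"
  assumes fin: "finite I" "finite J" and inj: "inj_on x I" "inj_on y J"
    and nonneg: "\<And>i. i \<in> I \<Longrightarrow> 0 \<le> a i" "\<And>j. j \<in> J \<Longrightarrow> 0 \<le> b j" and "sum a I = 1"
  shows "optimal_plans (dirac_sum I a x) (dirac_sum J b y) = matrix_plan I J x y ` optimal_matrices I J a b x y"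
proof -
  have couplings: "couplings (dirac_sum I a x) (dirac_sum J b y) = matrix_plan I J x y ` transport_matrices I J a b"
    using coupling_is_matrix_plan [of I J x y a b] matrix_plan_in_couplings [OF fin, of _ a b x y] assms
    by blast
  have "transport_cost (matrix_plan I J x y \<pi>) \<le> transport_cost (matrix_plan I J x y \<rho>) \<longleftrightarrow>
      matrix_cost I J x y \<pi> \<le> matrix_cost I J x y \<rho>"
    if "\<pi> \<in> transport_matrices I J a b" "\<rho> \<in> transport_matrices I J a b" for \<pi> \<rho>
    using that by (simp add: transport_cost_matrix_plan [OF fin] matrix_cost_nonneg ennreal_le_iff)
  then show ?thesis
    unfolding optimal_plans_def optimal_matrices_def couplings by auto
qed

lemma matrix_plan_permutation:
  fixes x :: "'i \<Rightarrow> 'a::euclidean_space" and y :: "'j \<Rightarrow> 'a"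
  assumes fin: "finite I" "finite J" and p: "\<And>i. i \<in> I \<Longrightarrow> p i \<in> J"
    and \<pi>: "\<And>i j. i \<in> I \<Longrightarrow> j \<in> J \<Longrightarrow> \<pi> (i, j) = (if j = p i then a i else 0)"
  shows "matrix_plan I J x y \<pi> = dirac_sum I a (\<lambda>i. (x i, y (p i)))"
proof (rule measure_eqI)
  fix A assume "A \<in> sets (matrix_plan I J x y \<pi>)"
  then have A: "A \<in> sets borel"
    by (simp add: matrix_plan_def)
  have "emeasure (matrix_plan I J x y \<pi>) A = (\<Sum>i\<in>I. \<Sum>j\<in>J. ennreal (\<pi> (i, j)) * emeasure (return borel (x i, y j)) A)"
    unfolding matrix_plan_def using fin A by (simp add: emeasure_dirac_sum sum.cartesian_product' del: emeasure_return)
  also have "\<dots> = (\<Sum>i\<in>I. ennreal (a i) * emeasure (return borel (x i, y (p i))) A)"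
  proof (intro sum.cong refl)
    fix i assume i: "i \<in> I"
    have "(\<Sum>j\<in>J. ennreal (\<pi> (i, j)) * emeasure (return borel (x i, y j)) A)
        = (\<Sum>j\<in>J. if j = p i then ennreal (a i) * emeasure (return borel (x i, y j)) A else 0)"
      using i by (intro sum.cong) (auto simp: \<pi>)
    then show "(\<Sum>j\<in>J. ennreal (\<pi> (i, j)) * emeasure (return borel (x i, y j)) A)
        = ennreal (a i) * emeasure (return borel (x i, y (p i))) A"
      using fin p [OF i] by simp
  qed
  also have "\<dots> = emeasure (dirac_sum I a (\<lambda>i. (x i, y (p i)))) A"
    using fin A by (simp add: emeasure_dirac_sum del: emeasure_return)
  finally show "emeasure (matrix_plan I J x y \<pi>) A = emeasure (dirac_sum I a (\<lambda>i. (x i, y (p i)))) A" .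
qed (simp add: matrix_plan_def)

text \<open>One optimal matrix selects in each row a positive entry, at column \<open>p i\<close>. A
  second optimal matrix with a positive entry elsewhere in that row would make the midpoint split,
  so all optimal matrices agree on the grid. Absence of column splits makes \<open>p\<close>
  injective, and positivity of \<open>b\<close> makes it surjective.\<close>

lemma unique_matching_if_no_split:
  fixes x :: "'i \<Rightarrow> 'a::euclidean_space" and y :: "'j \<Rightarrow> 'a"
  assumes fin: "finite I" "finite J" and inj: "inj_on x I" "inj_on y J"
    and pos: "\<And>i. i \<in> I \<Longrightarrow> 0 < a i" "\<And>j. j \<in> J \<Longrightarrow> 0 < b j"
    and sums: "sum a I = 1" "sum b J = 1"
    and no_row_split: "\<And>\<pi> i j j'. \<lbrakk>\<pi> \<in> optimal_matrices I J a b x y; i \<in> I; j \<in> J; j' \<in> J;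
        0 < \<pi> (i, j); 0 < \<pi> (i, j')\<rbrakk> \<Longrightarrow> j = j'"
    and no_column_split: "\<And>\<pi> i i' j. \<lbrakk>\<pi> \<in> optimal_matrices I J a b x y; i \<in> I; i' \<in> I; j \<in> J;
        0 < \<pi> (i, j); 0 < \<pi> (i', j)\<rbrakk> \<Longrightarrow> i = i'"
  shows "\<exists>p. bij_betw p I J \<and> (\<forall>i\<in>I. a i = b (p i)) \<and>
    optimal_plans (dirac_sum I a x) (dirac_sum J b y) = {dirac_sum I a (\<lambda>i. (x i, y (p i)))}"
proof -
  have nonneg: "\<And>i. i \<in> I \<Longrightarrow> 0 \<le> a i" "\<And>j. j \<in> J \<Longrightarrow> 0 \<le> b j"
    using pos by (auto intro: less_imp_le)
  obtain \<pi> where \<pi>: "\<pi> \<in> optimal_matrices I J a b x y"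
    using matrix_cost_minimizer [of I J a b x y] fin nonneg sums by (auto simp: optimal_matrices_def)
  have \<pi>': "\<pi> \<in> transport_matrices I J a b"
    using \<pi> by (simp add: optimal_matrices_def)
  \<comment> \<open>Otherwise the row sum could not be the positive number
    \<open>a i\<close>.\<close>
  have "\<exists>j\<in>J. 0 < \<pi> (i, j)" if "i \<in> I" for i
    using pos(1) [OF that] transport_matricesD(2) [OF \<pi>' that] by (metis not_less sum_nonpos)
  then obtain p where p: "\<And>i. i \<in> I \<Longrightarrow> p i \<in> J" "\<And>i. i \<in> I \<Longrightarrow> 0 < \<pi> (i, p i)"
    by metis
  have matching: "\<rho> (i, j) = (if j = p i then a i else 0)"
    if \<rho>: "\<rho> \<in> optimal_matrices I J a b x y" and ij: "i \<in> I" "j \<in> J" for \<rho> i j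
  proof -
    have \<rho>': "\<rho> \<in> transport_matrices I J a b"
      using \<rho> by (simp add: optimal_matrices_def)
    have zero: "\<rho> (i, l) = 0" if l: "l \<in> J" "l \<noteq> p i" for l
    proof (rule ccontr)
      assume "\<rho> (i, l) \<noteq> 0"
      with transport_matricesD(1) [OF \<rho>' ij(1) l(1)] have "0 < \<rho> (i, l)"
        by simp
      moreover have "0 \<le> \<pi> (i, l)" "0 \<le> \<rho> (i, p i)"
        using transport_matricesD(1) [OF \<pi>'] transport_matricesD(1) [OF \<rho>'] ij l p by auto
      \<comment> \<open>The midpoint is positive at \<open>l\<close> because of
        \<open>\<rho>\<close> and at \<open>p i\<close> because of \<open>\<pi>\<close>.\<close>
      ultimately have "l = p i"
        using no_row_split [OF optimal_matrices_midpoint [OF \<pi> \<rho>] ij(1) l(1), of "p i"] p ij(1)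
        by (simp add: add_pos_nonneg add_nonneg_pos)
      with l show False
        by simp
    qed
    have "a i = (\<Sum>l\<in>J. \<rho> (i, l))"
      using transport_matricesD(2) [OF \<rho>' ij(1)] by simp
    also have "\<dots> = (\<Sum>l\<in>{p i}. \<rho> (i, l))"
      using fin p(1) [OF ij(1)] zero by (intro sum.mono_neutral_right) auto
    finally show ?thesis
      using zero ij by auto
  qed
  have "inj_on p I"
    using no_column_split [OF \<pi>] p by (intro inj_onI) metis
  moreover have "p ` I = J"
  proof (intro antisym subsetI)
    fix j assume j: "j \<in> J"
    obtain i where i: "i \<in> I" "0 < \<pi> (i, j)"
      using pos(2) [OF j] transport_matricesD(3) [OF \<pi>' j] by (metis not_less sum_nonpos)
    then have "j = p i"
      using no_row_split [OF \<pi>, of i j "p i"] p j by simp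
    with i show "j \<in> p ` I"
      by simp
  qed (use p in auto)
  ultimately have bij: "bij_betw p I J"
    by (simp add: bij_betw_def)
  have "a i = b (p i)" if i: "i \<in> I" for i
  proof -
    have "b (p i) = (\<Sum>l\<in>I. \<pi> (l, p i))"
      using transport_matricesD(3) [OF \<pi>' p(1) [OF i]] by simp
    \<comment> \<open>By injectivity every other row has its only positive entry in another
      column.\<close>
    also have "\<dots> = (\<Sum>l\<in>{i}. \<pi> (l, p i))"
      using fin i p matching [OF \<pi>] \<open>inj_on p I\<close>
      by (intro sum.mono_neutral_right) (auto dest: inj_onD)
    finally show ?thesis
      using matching [OF \<pi> i p(1) [OF i]] by simp
  qed
  moreover have "matrix_plan I J x y \<rho> = dirac_sum I a (\<lambda>i. (x i, y (p i)))"
    if "\<rho> \<in> optimal_matrices I J a b x y" for \<rho>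
    using matching [OF that] p fin by (intro matrix_plan_permutation) auto
  then have "optimal_plans (dirac_sum I a x) (dirac_sum J b y) = {dirac_sum I a (\<lambda>i. (x i, y (p i)))}"
    using \<pi> by (auto simp: optimal_plans_dirac_sum [OF fin inj nonneg sums(1)])
  ultimately show ?thesis
    using bij by blast
qed

theorem theorem4p1:
  fixes m n :: nat
    and \<alpha> \<beta> :: "nat \<Rightarrow> real"
    and x y :: "nat \<Rightarrow> real ^ 'd"
    and \<mu> \<nu> :: "(real ^ 'd) measure"
  assumes "\<And>i. i \<in> {1..m} \<Longrightarrow> \<alpha> i > 0"
    and "\<And>j. j \<in> {1..n} \<Longrightarrow> \<beta> j > 0"
    and "(\<Sum>i=1..m. \<alpha> i) = 1"
    and "(\<Sum>j=1..n. \<beta> j) = 1"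
    and "inj_on x {1..m}"
    and "inj_on y {1..n}"
    and "\<mu> = dirac_sum {1..m} \<alpha> x"
    and "\<nu> = dirac_sum {1..n} \<beta> y"
    and "\<not> (\<exists>P. optimal_plans \<mu> \<nu> = {P} \<and> perfect_matching m \<alpha> x n \<beta> y P)"
  shows "\<exists>c\<^sub>0>0. \<exists>C>0. \<forall>\<sigma>\<in>{0<..<c\<^sub>0}.
           enn2real (W2_sq \<mu> \<nu>) - enn2real (W2_sq (\<mu> \<star> gaussian \<sigma>) (\<nu> \<star> gaussian \<sigma>)) \<ge> C * \<sigma>"
proof -
  let ?I = "{1..m}" and ?J = "{1..n}"
  let ?Opt = "optimal_matrices ?I ?J \<alpha> \<beta> x y"
  have fin: "finite ?I" "finite ?J"
    by simp_all
  have nonneg: "\<And>i. i \<in> ?I \<Longrightarrow> 0 \<le> \<alpha> i" "\<And>j. j \<in> ?J \<Longrightarrow> 0 \<le> \<beta> j"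
    using assms(1,2) by (auto intro: less_imp_le)
  have feasible: "\<pi> \<in> transport_matrices ?I ?J \<alpha> \<beta>" if "\<pi> \<in> ?Opt" for \<pi>
    using that by (simp add: optimal_matrices_def)
  have W2: "enn2real (W2_sq \<mu> \<nu>) = matrix_cost ?I ?J x y \<pi>" if "\<pi> \<in> ?Opt" for \<pi>
  proof -
    have "W2_sq \<mu> \<nu> = ennreal (matrix_cost ?I ?J x y \<pi>)"
      unfolding assms(7,8) by (rule W2_sq_dirac_sum [OF fin assms(5,6) _ _ assms(3) that]) (fact nonneg)+
    with matrix_cost_nonneg [OF feasible [OF that], of x y] show ?thesis
      by (metis enn2real_ennreal)
  qed
  let ?row_split = "\<lambda>\<pi> i j j'. i \<in> ?I \<and> j \<in> ?J \<and> j' \<in> ?J \<and> j \<noteq> j' \<and> 0 < \<pi> (i, j) \<and> 0 < \<pi> (i, j')"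
  let ?column_split = "\<lambda>\<pi> i i' j. i \<in> ?I \<and> i' \<in> ?I \<and> j \<in> ?J \<and> i \<noteq> i' \<and> 0 < \<pi> (i, j) \<and> 0 < \<pi> (i', j)"
  show ?thesis
  proof (cases "\<exists>\<pi>\<in>?Opt. \<exists>i j j'. ?row_split \<pi> i j j'")
    case True
    then obtain \<pi> i j j' where row: "\<pi> \<in> ?Opt" "i \<in> ?I" "j \<in> ?J" "j' \<in> ?J" "j \<noteq> j'" "0 < \<pi> (i, j)" "0 < \<pi> (i, j')"
      by blast
    show ?thesis
      unfolding W2 [OF row(1)] unfolding assms(7,8)
      by (rule gaussian_smoothing_gain_row_split [OF fin assms(6) _ _ assms(3,4) feasible [OF row(1)] row(2-)])
        (fact nonneg)+
  next
    case no_row_split: False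
    show ?thesis
    proof (cases "\<exists>\<pi>\<in>?Opt. \<exists>i i' j. ?column_split \<pi> i i' j")
      case True
      then obtain \<pi> i i' j where column: "\<pi> \<in> ?Opt" "i \<in> ?I" "i' \<in> ?I" "j \<in> ?J" "i \<noteq> i'" "0 < \<pi> (i, j)" "0 < \<pi> (i', j)"
        by blast
      \<comment> \<open>Transposing the matrix and exchanging the measures makes the column split a
        row split at \<open>j\<close>, with distinct targets \<open>x i\<close> and
        \<open>x i'\<close>.\<close>
      have "\<exists>c>0. \<exists>C>0. \<forall>\<sigma>\<in>{0<..<c}. C * \<sigma> \<le> matrix_cost ?J ?I y x (\<pi> \<circ> prod.swap) -
          enn2real (W2_sq (\<nu> \<star> gaussian \<sigma>) (\<mu> \<star> gaussian \<sigma>))"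
        unfolding assms(7,8)
      proof (rule gaussian_smoothing_gain_row_split [OF fin(2,1) assms(5) _ _ assms(4,3)])
        show "\<pi> \<circ> prod.swap \<in> transport_matrices ?J ?I \<beta> \<alpha>"
          by (intro transport_matrices_swap feasible column)
        show "0 < (\<pi> \<circ> prod.swap) (j, i)" "0 < (\<pi> \<circ> prod.swap) (j, i')"
          using column by auto
      qed (fact nonneg column)+
      then show ?thesis
        unfolding W2 [OF column(1)] matrix_cost_swap by (subst W2_sq_commute) simp_all
    next
      case no_column_split: False
      \<comment> \<open>Without any split the unique optimal plan is a perfect matching, contrary to
        assumption.\<close>
      have "\<exists>p. bij_betw p ?I ?J \<and> (\<forall>i\<in>?I. \<alpha> i = \<beta> (p i)) \<and> optimal_plans \<mu> \<nu> = {dirac_sum ?I \<alpha> (\<lambda>i. (x i, y (p i)))}"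
        unfolding assms(7,8)
      proof (rule unique_matching_if_no_split [OF fin assms(5,6) _ _ assms(3,4)])
        show "j = j'" if "\<pi> \<in> ?Opt" "i \<in> ?I" "j \<in> ?J" "j' \<in> ?J" "0 < \<pi> (i, j)" "0 < \<pi> (i, j')" for \<pi> i j j'
          using no_row_split that by blast
        show "i = i'" if "\<pi> \<in> ?Opt" "i \<in> ?I" "i' \<in> ?I" "j \<in> ?J" "0 < \<pi> (i, j)" "0 < \<pi> (i', j)" for \<pi> i i' j
          using no_column_split that by blast
      qed (fact assms(1,2))+
      then obtain p where p: "bij_betw p ?I ?J" "\<forall>i\<in>?I. \<alpha> i = \<beta> (p i)"
        "optimal_plans \<mu> \<nu> = {dirac_sum ?I \<alpha> (\<lambda>i. (x i, y (p i)))}"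
        by blast
      then have "m = n"
        using bij_betw_same_card by fastforce
      \<comment> \<open>\<open>permutes\<close> demands the identity outside the index set; this
        change leaves the measure as it is.\<close>
      define q where "q i = (if i \<in> ?I then p i else i)" for i
      have "bij_betw q ?I ?I \<longleftrightarrow> bij_betw p ?I ?I"
        by (intro bij_betw_cong) (simp add: q_def)
      with p(1) \<open>m = n\<close> have "bij_betw q ?I ?I"
        by simp
      then have "q permutes ?I"
        by (rule bij_imp_permutes) (auto simp: q_def)
      moreover have "dirac_sum ?I \<alpha> (\<lambda>i. (x i, y (p i))) = dirac_sum ?I \<alpha> (\<lambda>i. (x i, y (q i)))"
        unfolding dirac_sum_def by (intro distr_cong refl) (auto simp: q_def space_point_measure)
      moreover have "\<forall>i\<in>?I. \<alpha> i = \<beta> (q i)"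
        using p(2) by (simp add: q_def)
      ultimately have "perfect_matching m \<alpha> x n \<beta> y (dirac_sum ?I \<alpha> (\<lambda>i. (x i, y (p i))))"
        unfolding perfect_matching_def using \<open>m = n\<close> by (intro conjI exI [of _ q])
      with p(3) assms(9) show ?thesis
        by blast
    qed
  qed
qed

end
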